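(* Let $G$ be a group, $B\le G$ a subgroup, and let $1\to R\to Q\xrightarrow{\pi} S\to 1$ be a short exact sequence of $G$-groups such that the image of $R$ in $Q$ is contained in the centre $Z(Q)$. Let $\sigma:S\to Q$ be a section of $\pi$ (not necessarily a homomorphism). Consider the commutative diagram with exact rows (of pointed sets) whose vertical maps are restrictions from $G$ to $B$: $$\begin{array}{ccccccccc} S^G &\xrightarrow{\delta_G}& H^1(G,R)&\xrightarrow{\iota_G}& H^1(G,Q)&\xrightarrow{\pi_G}& H^1(G,S)&\xrightarrow{\Delta_G}& H^2(G,R)\\ \downarrow h_1&&\downarrow h_2&&\downarrow h_3&&\downarrow h_4&&\downarrow h_5\\ S^B &\xrightarrow{\delta_B}& H^1(B,R)&\xrightarrow{\iota_B}& H^1(B,Q)&\xrightarrow{\pi_B}& H^1(B,S)&\xrightarrow{\Delta_B}& H^2(B,R).\end{array}$$ Then: (i) If $h_2$ and $h_4$ are surjective and $h_5$ is injective, then $h_3$ is surjective. (ii) If $h_2$ and $h_4$ are injective and, for every $\gamma\in Z^1(G,S)$ with restriction $\beta=\gamma|_B\in Z^1(B,S)$, the restriction map (inclusion) $S_\gamma^G\to S_\beta^B$ is surjective, then $h_3$ is injective. (iii) If the hypotheses of (i) and (ii) hold, then $h_3$ is an isomorphism (of pointed sets).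
   Context: A $G$-group is a group $Q$ with a right action $(q,g)\mapsto q^g$ of $G$ by group automorphisms; maps of $G$-groups are $G$-equivariant homomorphisms. Write $q^{-g}=(q^{-1})^g$. $H^0(G,Q)=Q^G=\{q\in Q: q^g=q\ \forall g\in G\}$. $Z^1(G,Q)$ is the set of maps $\gamma:G\to Q$ with $\gamma(gh)=\gamma(g)^h\gamma(h)$; $\gamma\sim\delta$ if there is $q\in Q$ with $\delta(g)=q^{-g}\gamma(g)q$ for all $g$; $H^1(G,Q)=Z^1(G,Q)/\!\sim$, a pointed set with base point the class of the trivial cocycle. For an abelian $G$-group $R$, $Z^2(G,R)$ is the set of maps $\gamma:G\times G\to R$ with $\gamma(gh,k)\gamma(g,h)^k=\gamma(g,hk)\gamma(h,k)$; $\gamma\sim\delta$ if there is a map $\phi:G\to R$ with $\delta(g,h)=\gamma(g,h)\phi(g)^h\phi(h)\phi(gh)^{-1}$; $H^2(G,R)=Z^2(G,R)/\!\sim$, pointed by the class of the trivial cocycle. Maps: $\iota_G,\pi_G$ are induced by $R\to Q$ and $Q\to S$; $\delta_G(s)$ is the class of $g\mapsto \sigma(s)^{-g}\sigma(s)$; $\Delta_G([\gamma])$ is the class of $(g,h)\mapsto\sigma(\gamma(g))^h\sigma(\gamma(h))\sigma(\gamma(gh))^{-1}$ (elements of $R$ identified with their images in $Q$); similarly for $B$. Twisting: for $\gamma\in Z^1(G,S)$, $S_\gamma$ is the group $S$ with the new $G$-action $s*g=\gamma(g)^{-1}s^g\gamma(g)$; $S_\gamma^G$ is its group of $G$-fixed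 points. Likewise $S_\beta$ is $S$ with the $B$-action twisted by $\beta$. *)

theory Defs
  imports "HOL-Algebra.Algebra"
begin

text \<open>
  A right action of \<open>G\<close> on \<open>Q\<close> is a function \<open>a\<close> with \<open>a q g\<close> standing for \<open>q\<^sup>g\<close>, so that
  \<open>a (inv q) g\<close> stands for \<open>q\<^sup>-\<^sup>g\<close>. Bijectivity of each \<open>q \<mapsto> q\<^sup>g\<close> follows from the two action laws.
\<close>

locale G_group = G: group G + Q: group Q
  for G :: "('g, 'x) monoid_scheme" and Q :: "('q, 'y) monoid_scheme"
    and a :: "'q \<Rightarrow> 'g \<Rightarrow> 'q" +
  assumes act_hom: "g \<in> carrier G \<Longrightarrow> (\<lambda>q. a q g) \<in> hom Q Q"
    and act_one: "q \<in> carrier Q \<Longrightarrow> a q \<one>\<^bsub>G\<^esub> = q"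
    and act_mult: "\<lbrakk>q \<in> carrier Q; g \<in> carrier G; h \<in> carrier G\<rbrakk>
      \<Longrightarrow> a q (g \<otimes>\<^bsub>G\<^esub> h) = a (a q g) h"

definition equivariant ::
  "('g, 'x) monoid_scheme \<Rightarrow> ('q, 'y) monoid_scheme \<Rightarrow> ('q \<Rightarrow> 'g \<Rightarrow> 'q) \<Rightarrow> ('t \<Rightarrow> 'g \<Rightarrow> 't)
    \<Rightarrow> ('q \<Rightarrow> 't) \<Rightarrow> bool"
  where "equivariant G Q aQ aT f \<longleftrightarrow>
    (\<forall>q\<in>carrier Q. \<forall>g\<in>carrier G. f (aQ q g) = aT (f q) g)"

definition group_center :: "('q, 'y) monoid_scheme \<Rightarrow> 'q set"
  where "group_center Q = {z \<in> carrier Q. \<forall>q\<in>carrier Q. z \<otimes>\<^bsub>Q\<^esub> q = q \<otimes>\<^bsub>Q\<^esub> z}"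


subsection \<open>Cohomology in degrees 0, 1 and 2\<close>

text \<open>
  Cocycles are extensional functions, so that they correspond exactly to maps defined on the
  carrier. The \<open>H1\<close> and \<open>H2\<close> below are sets of equivalence classes.
\<close>

definition H0 ::
  "('g, 'x) monoid_scheme \<Rightarrow> ('q, 'y) monoid_scheme \<Rightarrow> ('q \<Rightarrow> 'g \<Rightarrow> 'q) \<Rightarrow> 'q set"
  where "H0 G Q a = {q \<in> carrier Q. \<forall>g\<in>carrier G. a q g = q}"

definition Z1 ::
  "('g, 'x) monoid_scheme \<Rightarrow> ('q, 'y) monoid_scheme \<Rightarrow> ('q \<Rightarrow> 'g \<Rightarrow> 'q) \<Rightarrow> ('g \<Rightarrow> 'q) set"
  where "Z1 G Q a = {\<gamma> \<in> carrier G \<rightarrow>\<^sub>E carrier Q.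
    \<forall>g\<in>carrier G. \<forall>h\<in>carrier G. \<gamma> (g \<otimes>\<^bsub>G\<^esub> h) = a (\<gamma> g) h \<otimes>\<^bsub>Q\<^esub> \<gamma> h}"

definition H1_rel ::
  "('g, 'x) monoid_scheme \<Rightarrow> ('q, 'y) monoid_scheme \<Rightarrow> ('q \<Rightarrow> 'g \<Rightarrow> 'q)
    \<Rightarrow> (('g \<Rightarrow> 'q) \<times> ('g \<Rightarrow> 'q)) set"
  where "H1_rel G Q a = {(\<gamma>, \<delta>). \<gamma> \<in> Z1 G Q a \<and> \<delta> \<in> Z1 G Q a \<and>
    (\<exists>q\<in>carrier Q. \<forall>g\<in>carrier G. \<delta> g = a (inv\<^bsub>Q\<^esub> q) g \<otimes>\<^bsub>Q\<^esub> \<gamma> g \<otimes>\<^bsub>Q\<^esub> q)}"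

definition H1 ::
  "('g, 'x) monoid_scheme \<Rightarrow> ('q, 'y) monoid_scheme \<Rightarrow> ('q \<Rightarrow> 'g \<Rightarrow> 'q) \<Rightarrow> ('g \<Rightarrow> 'q) set set"
  where "H1 G Q a = Z1 G Q a // H1_rel G Q a"

definition H1_class ::
  "('g, 'x) monoid_scheme \<Rightarrow> ('q, 'y) monoid_scheme \<Rightarrow> ('q \<Rightarrow> 'g \<Rightarrow> 'q)
    \<Rightarrow> ('g \<Rightarrow> 'q) \<Rightarrow> ('g \<Rightarrow> 'q) set"
  where "H1_class G Q a \<gamma> = H1_rel G Q a `` {\<gamma>}"

definition H1_base ::
  "('g, 'x) monoid_scheme \<Rightarrow> ('q, 'y) monoid_scheme \<Rightarrow> ('q \<Rightarrow> 'g \<Rightarrow> 'q) \<Rightarrow> ('g \<Rightarrow> 'q) set"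
  where "H1_base G Q a = H1_class G Q a (\<lambda>g\<in>carrier G. \<one>\<^bsub>Q\<^esub>)"

definition Z2 ::
  "('g, 'x) monoid_scheme \<Rightarrow> ('r, 'y) monoid_scheme \<Rightarrow> ('r \<Rightarrow> 'g \<Rightarrow> 'r) \<Rightarrow> ('g \<times> 'g \<Rightarrow> 'r) set"
  where "Z2 G R a = {\<gamma> \<in> carrier G \<times> carrier G \<rightarrow>\<^sub>E carrier R.
    \<forall>g\<in>carrier G. \<forall>h\<in>carrier G. \<forall>k\<in>carrier G.
      \<gamma> (g \<otimes>\<^bsub>G\<^esub> h, k) \<otimes>\<^bsub>R\<^esub> a (\<gamma> (g, h)) k = \<gamma> (g, h \<otimes>\<^bsub>G\<^esub> k) \<otimes>\<^bsub>R\<^esub> \<gamma> (h, k)}"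

definition H2_rel ::
  "('g, 'x) monoid_scheme \<Rightarrow> ('r, 'y) monoid_scheme \<Rightarrow> ('r \<Rightarrow> 'g \<Rightarrow> 'r)
    \<Rightarrow> (('g \<times> 'g \<Rightarrow> 'r) \<times> ('g \<times> 'g \<Rightarrow> 'r)) set"
  where "H2_rel G R a = {(\<gamma>, \<delta>). \<gamma> \<in> Z2 G R a \<and> \<delta> \<in> Z2 G R a \<and>
    (\<exists>\<phi> \<in> carrier G \<rightarrow> carrier R. \<forall>g\<in>carrier G. \<forall>h\<in>carrier G.
      \<delta> (g, h) = \<gamma> (g, h) \<otimes>\<^bsub>R\<^esub> a (\<phi> g) h \<otimes>\<^bsub>R\<^esub> \<phi> h \<otimes>\<^bsub>R\<^esub> inv\<^bsub>R\<^esub> (\<phi> (g \<otimes>\<^bsub>G\<^esub> h)))}"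

definition H2 ::
  "('g, 'x) monoid_scheme \<Rightarrow> ('r, 'y) monoid_scheme \<Rightarrow> ('r \<Rightarrow> 'g \<Rightarrow> 'r)
    \<Rightarrow> ('g \<times> 'g \<Rightarrow> 'r) set set"
  where "H2 G R a = Z2 G R a // H2_rel G R a"

definition H2_class ::
  "('g, 'x) monoid_scheme \<Rightarrow> ('r, 'y) monoid_scheme \<Rightarrow> ('r \<Rightarrow> 'g \<Rightarrow> 'r)
    \<Rightarrow> ('g \<times> 'g \<Rightarrow> 'r) \<Rightarrow> ('g \<times> 'g \<Rightarrow> 'r) set"
  where "H2_class G R a \<gamma> = H2_rel G R a `` {\<gamma>}"

definition H2_base ::
  "('g, 'x) monoid_scheme \<Rightarrow> ('r, 'y) monoid_scheme \<Rightarrow> ('r \<Rightarrow> 'g \<Rightarrow> 'r) \<Rightarrow> ('g \<times> 'g \<Rightarrow> 'r) set"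
  where "H2_base G R a = H2_class G R a (\<lambda>x\<in>carrier G \<times> carrier G. \<one>\<^bsub>R\<^esub>)"


subsection \<open>Maps between cohomology sets\<close>

text \<open>
  A map on a quotient is obtained from a map on representatives by taking the union, over all
  representatives, of the resulting classes. This is the intended class whenever the map on
  representatives respects the equivalence relations.
\<close>

definition H1_map ::
  "('g, 'x) monoid_scheme \<Rightarrow> ('t, 'z) monoid_scheme \<Rightarrow> ('t \<Rightarrow> 'g \<Rightarrow> 't) \<Rightarrow> ('q \<Rightarrow> 't)
    \<Rightarrow> ('g \<Rightarrow> 'q) set \<Rightarrow> ('g \<Rightarrow> 't) set"
  where "H1_map G T aT f c = (\<Union>\<gamma>\<in>c. H1_class G T aT (\<lambda>g\<in>carrier G. f (\<gamma> g)))"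

text \<open>Elements of \<open>R\<close> are identified with their images under the injection \<open>i\<close> from \<open>R\<close> to \<open>Q\<close>;
  \<open>inv_into (carrier R) i\<close> undoes this identification.\<close>

definition connecting0 ::
  "('g, 'x) monoid_scheme \<Rightarrow> ('r, 'u) monoid_scheme \<Rightarrow> ('r \<Rightarrow> 'g \<Rightarrow> 'r)
    \<Rightarrow> ('q, 'v) monoid_scheme \<Rightarrow> ('q \<Rightarrow> 'g \<Rightarrow> 'q) \<Rightarrow> ('r \<Rightarrow> 'q) \<Rightarrow> ('s \<Rightarrow> 'q)
    \<Rightarrow> 's \<Rightarrow> ('g \<Rightarrow> 'r) set"
  where "connecting0 G R aR Q aQ i \<sigma> s =
    H1_class G R aR (\<lambda>g\<in>carrier G.
      inv_into (carrier R) i (aQ (inv\<^bsub>Q\<^esub> (\<sigma> s)) g \<otimes>\<^bsub>Q\<^esub> \<sigma> s))"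

definition connecting1 ::
  "('g, 'x) monoid_scheme \<Rightarrow> ('r, 'u) monoid_scheme \<Rightarrow> ('r \<Rightarrow> 'g \<Rightarrow> 'r)
    \<Rightarrow> ('q, 'v) monoid_scheme \<Rightarrow> ('q \<Rightarrow> 'g \<Rightarrow> 'q) \<Rightarrow> ('r \<Rightarrow> 'q) \<Rightarrow> ('s \<Rightarrow> 'q)
    \<Rightarrow> ('g \<Rightarrow> 's) set \<Rightarrow> ('g \<times> 'g \<Rightarrow> 'r) set"
  where "connecting1 G R aR Q aQ i \<sigma> c =
    (\<Union>\<gamma>\<in>c. H2_class G R aR (\<lambda>(g, h)\<in>carrier G \<times> carrier G.
      inv_into (carrier R) i
        (aQ (\<sigma> (\<gamma> g)) h \<otimes>\<^bsub>Q\<^esub> \<sigma> (\<gamma> h) \<otimes>\<^bsub>Q\<^esub> inv\<^bsub>Q\<^esub> (\<sigma> (\<gamma> (g \<otimes>\<^bsub>G\<^esub> h))))))"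

definition H0_res ::
  "('g, 'x) monoid_scheme \<Rightarrow> ('q, 'y) monoid_scheme \<Rightarrow> ('q \<Rightarrow> 'g \<Rightarrow> 'q) \<Rightarrow> 'q \<Rightarrow> 'q"
  where "H0_res G Q a = (\<lambda>q\<in>H0 G Q a. q)"

definition H1_res ::
  "('g, 'x) monoid_scheme \<Rightarrow> 'g set \<Rightarrow> ('q, 'y) monoid_scheme \<Rightarrow> ('q \<Rightarrow> 'g \<Rightarrow> 'q)
    \<Rightarrow> ('g \<Rightarrow> 'q) set \<Rightarrow> ('g \<Rightarrow> 'q) set"
  where "H1_res G B Q a c = (\<Union>\<gamma>\<in>c. H1_class (G\<lparr>carrier := B\<rparr>) Q a (restrict \<gamma> B))"

definition H2_res ::
  "('g, 'x) monoid_scheme \<Rightarrow> 'g set \<Rightarrow> ('r, 'y) monoid_scheme \<Rightarrow> ('r \<Rightarrow> 'g \<Rightarrow> 'r)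
    \<Rightarrow> ('g \<times> 'g \<Rightarrow> 'r) set \<Rightarrow> ('g \<times> 'g \<Rightarrow> 'r) set"
  where "H2_res G B R a c = (\<Union>\<gamma>\<in>c. H2_class (G\<lparr>carrier := B\<rparr>) R a (restrict \<gamma> (B \<times> B)))"

definition twist ::
  "('s, 'y) monoid_scheme \<Rightarrow> ('s \<Rightarrow> 'g \<Rightarrow> 's) \<Rightarrow> ('g \<Rightarrow> 's) \<Rightarrow> 's \<Rightarrow> 'g \<Rightarrow> 's"
  where "twist S a \<gamma> s g = inv\<^bsub>S\<^esub> (\<gamma> g) \<otimes>\<^bsub>S\<^esub> a s g \<otimes>\<^bsub>S\<^esub> \<gamma> g"


subsection \<open>Pointed sets\<close>

definition pointed_map :: "'a set \<Rightarrow> 'a \<Rightarrow> 'b set \<Rightarrow> 'b \<Rightarrow> ('a \<Rightarrow> 'b) \<Rightarrow> bool"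
  where "pointed_map U u V v f \<longleftrightarrow> u \<in> U \<and> v \<in> V \<and> f \<in> U \<rightarrow> V \<and> f u = v"

definition pointed_iso :: "'a set \<Rightarrow> 'a \<Rightarrow> 'b set \<Rightarrow> 'b \<Rightarrow> ('a \<Rightarrow> 'b) \<Rightarrow> bool"
  where "pointed_iso U u V v f \<longleftrightarrow> pointed_map U u V v f \<and> bij_betw f U V"

text \<open>Exactness of \<open>U \<rightarrow> V \<rightarrow> (W, w)\<close> at \<open>V\<close>.\<close>

definition exact_at :: "'a set \<Rightarrow> ('a \<Rightarrow> 'b) \<Rightarrow> 'b set \<Rightarrow> ('b \<Rightarrow> 'c) \<Rightarrow> 'c \<Rightarrow> bool"
  where "exact_at U f V k w \<longleftrightarrow> f ` U = {v \<in> V. k v = w}"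

text \<open>The sequence of pointed sets
  \<open>S\<^sup>G \<rightarrow> H\<^sup>1(G,R) \<rightarrow> H\<^sup>1(G,Q) \<rightarrow> H\<^sup>1(G,S) \<rightarrow> H\<^sup>2(G,R)\<close> is exact.\<close>

definition exact_row ::
  "('g, 'x) monoid_scheme \<Rightarrow> ('r, 'u) monoid_scheme \<Rightarrow> ('r \<Rightarrow> 'g \<Rightarrow> 'r)
    \<Rightarrow> ('q, 'v) monoid_scheme \<Rightarrow> ('q \<Rightarrow> 'g \<Rightarrow> 'q)
    \<Rightarrow> ('s, 'w) monoid_scheme \<Rightarrow> ('s \<Rightarrow> 'g \<Rightarrow> 's)
    \<Rightarrow> ('r \<Rightarrow> 'q) \<Rightarrow> ('q \<Rightarrow> 's) \<Rightarrow> ('s \<Rightarrow> 'q) \<Rightarrow> bool"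
  where "exact_row G R aR Q aQ S aS i p \<sigma> \<longleftrightarrow>
    pointed_map (H0 G S aS) \<one>\<^bsub>S\<^esub> (H1 G R aR) (H1_base G R aR)
      (connecting0 G R aR Q aQ i \<sigma>) \<and>
    pointed_map (H1 G R aR) (H1_base G R aR) (H1 G Q aQ) (H1_base G Q aQ)
      (H1_map G Q aQ i) \<and>
    pointed_map (H1 G Q aQ) (H1_base G Q aQ) (H1 G S aS) (H1_base G S aS)
      (H1_map G S aS p) \<and>
    pointed_map (H1 G S aS) (H1_base G S aS) (H2 G R aR) (H2_base G R aR)
      (connecting1 G R aR Q aQ i \<sigma>) \<and>
    exact_at (H0 G S aS) (connecting0 G R aR Q aQ i \<sigma>)
      (H1 G R aR) (H1_map G Q aQ i) (H1_base G Q aQ) \<and>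
    exact_at (H1 G R aR) (H1_map G Q aQ i)
      (H1 G Q aQ) (H1_map G S aS p) (H1_base G S aS) \<and>
    exact_at (H1 G Q aQ) (H1_map G S aS p)
      (H1 G S aS) (connecting1 G R aR Q aQ i \<sigma>) (H2_base G R aR)"

text \<open>The restriction maps from \<open>G\<close> to \<open>B\<close> are maps of pointed sets and commute with the
  maps of the two rows.\<close>

definition restriction_commutes ::
  "('g, 'x) monoid_scheme \<Rightarrow> 'g set \<Rightarrow> ('r, 'u) monoid_scheme \<Rightarrow> ('r \<Rightarrow> 'g \<Rightarrow> 'r)
    \<Rightarrow> ('q, 'v) monoid_scheme \<Rightarrow> ('q \<Rightarrow> 'g \<Rightarrow> 'q)
    \<Rightarrow> ('s, 'w) monoid_scheme \<Rightarrow> ('s \<Rightarrow> 'g \<Rightarrow> 's)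
    \<Rightarrow> ('r \<Rightarrow> 'q) \<Rightarrow> ('q \<Rightarrow> 's) \<Rightarrow> ('s \<Rightarrow> 'q) \<Rightarrow> bool"
  where "restriction_commutes G B R aR Q aQ S aS i p \<sigma> \<longleftrightarrow>
    (let K = G\<lparr>carrier := B\<rparr> in
    pointed_map (H0 G S aS) \<one>\<^bsub>S\<^esub> (H0 K S aS) \<one>\<^bsub>S\<^esub> (H0_res G S aS) \<and>
    pointed_map (H1 G R aR) (H1_base G R aR) (H1 K R aR) (H1_base K R aR) (H1_res G B R aR) \<and>
    pointed_map (H1 G Q aQ) (H1_base G Q aQ) (H1 K Q aQ) (H1_base K Q aQ) (H1_res G B Q aQ) \<and>
    pointed_map (H1 G S aS) (H1_base G S aS) (H1 K S aS) (H1_base K S aS) (H1_res G B S aS) \<and>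
    pointed_map (H2 G R aR) (H2_base G R aR) (H2 K R aR) (H2_base K R aR) (H2_res G B R aR) \<and>
    (\<forall>s\<in>H0 G S aS. H1_res G B R aR (connecting0 G R aR Q aQ i \<sigma> s) =
      connecting0 K R aR Q aQ i \<sigma> (H0_res G S aS s)) \<and>
    (\<forall>c\<in>H1 G R aR. H1_res G B Q aQ (H1_map G Q aQ i c) =
      H1_map K Q aQ i (H1_res G B R aR c)) \<and>
    (\<forall>c\<in>H1 G Q aQ. H1_res G B S aS (H1_map G S aS p c) =
      H1_map K S aS p (H1_res G B Q aQ c)) \<and>
    (\<forall>c\<in>H1 G S aS. H2_res G B R aR (connecting1 G R aR Q aQ i \<sigma> c) =
      connecting1 K R aR Q aQ i \<sigma> (H1_res G B S aS c)))"

end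

theory Submission
  imports Defs
begin

text \<open>
  A cochain \<open>u\<close> of \<open>G\<close> in \<open>Q\<close> lifting a cocycle in \<open>S\<close> satisfies \<open>u(g)\<^sup>h u(h) = c(g,h) u(gh)\<close> with
  \<open>c\<close> a 2-cocycle in \<open>R\<close>; changing \<open>u\<close> by a cochain in \<open>R\<close> changes \<open>c\<close> by a coboundary, so the
  class of \<open>c\<close> vanishes exactly when the cocycle lifts. Since \<open>R\<close> is central, \<open>H\<^sup>1(G,R)\<close> acts on
  \<open>H\<^sup>1(G,Q)\<close> by pointwise multiplication, transitively on the fibres over \<open>H\<^sup>1(G,S)\<close>.

  Surjectivity: lift the image in \<open>H\<^sup>1(B,S)\<close> to \<open>G\<close>, then to \<open>H\<^sup>1(G,Q)\<close> because the obstruction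
  vanishes after restriction, and correct by the action. Injectivity: if \<open>\<gamma>\<close> and \<open>\<delta>\<close> agree on \<open>B\<close>,
  then \<open>\<delta> \<sim> \<gamma>\<rho>\<close> with \<open>\<rho>\<close> in \<open>R\<close>, and some \<open>q\<close> conjugates \<open>\<gamma>\<close> to \<open>\<gamma>\<rho>\<close> over \<open>B\<close>. The image of \<open>q\<close>
  in \<open>S\<close> is then fixed by the action of \<open>B\<close> twisted by \<open>\<gamma>\<close>, hence by that of \<open>G\<close>, so \<open>q\<close> conjugates
  \<open>\<gamma>\<close> to \<open>\<gamma>\<rho>'\<close> over \<open>G\<close> with \<open>\<rho>'\<close> in \<open>R\<close>. Here \<open>\<rho> = \<rho>'\<close> on \<open>B\<close>, so \<open>\<rho> \<sim> \<rho>'\<close> and \<open>\<delta> \<sim> \<gamma>\<close>.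
\<close>

section \<open>First cohomology sets\<close>

text \<open>In right-nested words an adjacent pair of inverse factors is followed by a tail and
  escapes the plain inverse laws. These forms cancel it there, so rewriting settles the word
  identities below.\<close>

lemma (in group) inv_cancel_left:
  assumes "x \<in> carrier G" "y \<in> carrier G"
  shows "inv x \<otimes> (x \<otimes> y) = y" and "x \<otimes> (inv x \<otimes> y) = y"
  using assms by (simp_all flip: m_assoc)

text \<open>Restriction and push-forward commute as functions, not only up to equivalence: both
  sides are extensional on \<open>B\<close>. The right-hand side is the push-forward of a cocycle of
  the subgroup.\<close>

lemma restrict_map_subgroup:
  "subgroup B G \<Longrightarrow> restrict (\<lambda>g\<in>carrier G. f (\<gamma> g)) B = (\<lambda>g\<in>B. f (restrict \<gamma> B g))"
  using subgroup.mem_carrier[of B G] by auto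

lemma Z1I:
  assumes "\<gamma> \<in> carrier G \<rightarrow>\<^sub>E carrier Q"
    and "\<And>g h. \<lbrakk>g \<in> carrier G; h \<in> carrier G\<rbrakk>
      \<Longrightarrow> \<gamma> (g \<otimes>\<^bsub>G\<^esub> h) = a (\<gamma> g) h \<otimes>\<^bsub>Q\<^esub> \<gamma> h"
  shows "\<gamma> \<in> Z1 G Q a"
  using assms by (simp add: Z1_def)

lemma Z1_closed: "\<lbrakk>\<gamma> \<in> Z1 G Q a; g \<in> carrier G\<rbrakk> \<Longrightarrow> \<gamma> g \<in> carrier Q"
  by (auto simp: Z1_def)

lemma Z1_mult:
  "\<lbrakk>\<gamma> \<in> Z1 G Q a; g \<in> carrier G; h \<in> carrier G\<rbrakk>
    \<Longrightarrow> \<gamma> (g \<otimes>\<^bsub>G\<^esub> h) = a (\<gamma> g) h \<otimes>\<^bsub>Q\<^esub> \<gamma> h"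
  by (simp add: Z1_def)

lemma Z1_eqI:
  assumes "\<gamma> \<in> Z1 G Q a" "\<delta> \<in> Z1 G Q a" "\<And>g. g \<in> carrier G \<Longrightarrow> \<gamma> g = \<delta> g"
  shows "\<gamma> = \<delta>"
  using assms by (auto simp: Z1_def intro: PiE_ext)

lemma Z1_restrict_eq: "\<gamma> \<in> Z1 G Q a \<Longrightarrow> restrict \<gamma> (carrier G) = \<gamma>"
  by (auto simp: Z1_def PiE_def extensional_restrict)

lemma H1_relI:
  assumes "\<gamma> \<in> Z1 G Q a" "\<delta> \<in> Z1 G Q a" "q \<in> carrier Q"
    and "\<And>g. g \<in> carrier G \<Longrightarrow> \<delta> g = a (inv\<^bsub>Q\<^esub> q) g \<otimes>\<^bsub>Q\<^esub> \<gamma> g \<otimes>\<^bsub>Q\<^esub> q"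
  shows "(\<gamma>, \<delta>) \<in> H1_rel G Q a"
  using assms by (auto simp: H1_rel_def)

lemma H1_relE:
  assumes "(\<gamma>, \<delta>) \<in> H1_rel G Q a"
  obtains q where "\<gamma> \<in> Z1 G Q a" "\<delta> \<in> Z1 G Q a" "q \<in> carrier Q"
    and "\<forall>g\<in>carrier G. \<delta> g = a (inv\<^bsub>Q\<^esub> q) g \<otimes>\<^bsub>Q\<^esub> \<gamma> g \<otimes>\<^bsub>Q\<^esub> q"
  using assms by (auto simp: H1_rel_def)

lemma H1_relD:
  assumes "(\<gamma>, \<delta>) \<in> H1_rel G Q a"
  shows "\<gamma> \<in> Z1 G Q a" "\<delta> \<in> Z1 G Q a"
  using assms by (auto simp: H1_rel_def)

lemma H1E:
  assumes "c \<in> H1 G Q a"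
  obtains \<gamma> where "\<gamma> \<in> Z1 G Q a" "c = H1_class G Q a \<gamma>"
  using assms by (auto simp: H1_def H1_class_def elim: quotientE)

lemma H1_class_in_H1: "\<gamma> \<in> Z1 G Q a \<Longrightarrow> H1_class G Q a \<gamma> \<in> H1 G Q a"
  by (auto simp: H1_def H1_class_def quotient_def)

lemma H2E:
  assumes "c \<in> H2 G R a"
  obtains \<gamma> where "\<gamma> \<in> Z2 G R a" "c = H2_class G R a \<gamma>"
  using assms by (auto simp: H2_def H2_class_def elim: quotientE)

lemma H2_class_in_H2: "\<gamma> \<in> Z2 G R a \<Longrightarrow> H2_class G R a \<gamma> \<in> H2 G R a"
  by (auto simp: H2_def H2_class_def quotient_def)

section \<open>Action laws, equivalence of 1-cocycles, and restriction to a subgroup\<close>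

context G_group
begin

lemma act_closed: "\<lbrakk>q \<in> carrier Q; g \<in> carrier G\<rbrakk> \<Longrightarrow> a q g \<in> carrier Q"
  using act_hom[of g] by (auto simp: hom_def)

lemma act_group_hom: "g \<in> carrier G \<Longrightarrow> group_hom Q Q (\<lambda>q. a q g)"
  by (simp add: Q.is_group act_hom group_hom.intro group_hom_axioms.intro)

lemma act_distrib:
  "\<lbrakk>x \<in> carrier Q; y \<in> carrier Q; g \<in> carrier G\<rbrakk>
    \<Longrightarrow> a (x \<otimes>\<^bsub>Q\<^esub> y) g = a x g \<otimes>\<^bsub>Q\<^esub> a y g"
  using act_hom[of g] by (auto simp: hom_def)

lemma act_inv:
  "\<lbrakk>x \<in> carrier Q; g \<in> carrier G\<rbrakk> \<Longrightarrow> a (inv\<^bsub>Q\<^esub> x) g = inv\<^bsub>Q\<^esub> (a x g)"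
  using group_hom.hom_inv[OF act_group_hom] by simp

lemma act_of_one: "g \<in> carrier G \<Longrightarrow> a \<one>\<^bsub>Q\<^esub> g = \<one>\<^bsub>Q\<^esub>"
  using group_hom.hom_one[OF act_group_hom] by simp

lemmas act_simps = act_closed act_distrib act_inv act_of_one act_mult
lemmas Q_simps = Q.m_assoc Q.inv_mult_group Q.inv_cancel_left

lemma trivial_cocycle: "(\<lambda>g\<in>carrier G. \<one>\<^bsub>Q\<^esub>) \<in> Z1 G Q a"
  by (rule Z1I) (auto simp: act_simps)

text \<open>In the product of the value at \<open>g\<close>, moved by \<open>h\<close>, with the
  value at \<open>h\<close>, the inner factors q^h and q^(-h) cancel.\<close>

lemma conj_cocycle:
  assumes "\<gamma> \<in> Z1 G Q a" "q \<in> carrier Q"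
  shows "(\<lambda>g\<in>carrier G. a (inv\<^bsub>Q\<^esub> q) g \<otimes>\<^bsub>Q\<^esub> \<gamma> g \<otimes>\<^bsub>Q\<^esub> q) \<in> Z1 G Q a"
  using assms by (intro Z1I) (auto simp: Z1_closed Z1_mult act_simps Q_simps)

lemma conj_cocycle_rel:
  assumes "\<gamma> \<in> Z1 G Q a" "q \<in> carrier Q"
  shows "(\<gamma>, \<lambda>g\<in>carrier G. a (inv\<^bsub>Q\<^esub> q) g \<otimes>\<^bsub>Q\<^esub> \<gamma> g \<otimes>\<^bsub>Q\<^esub> q) \<in> H1_rel G Q a"
  using assms by (intro H1_relI conj_cocycle) auto

text \<open>Conjugation is a right action of \<open>Q\<close> on cocycles whose orbits are the
  classes, so the witnesses are the identity, the inverse and the product.\<close>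

lemma equiv_H1_rel: "equiv (Z1 G Q a) (H1_rel G Q a)"
proof (rule equivI)
  show "H1_rel G Q a \<subseteq> Z1 G Q a \<times> Z1 G Q a"
    by (auto simp: H1_rel_def)
  show "refl_on (Z1 G Q a) (H1_rel G Q a)"
  proof (rule refl_onI)
    fix \<gamma> assume "\<gamma> \<in> Z1 G Q a"
    then show "(\<gamma>, \<gamma>) \<in> H1_rel G Q a"
      by (intro H1_relI[where q = "\<one>\<^bsub>Q\<^esub>"]) (simp_all add: act_simps Z1_closed)
  qed
  show "sym (H1_rel G Q a)"
  proof (rule symI)
    fix \<gamma> \<delta> assume "(\<gamma>, \<delta>) \<in> H1_rel G Q a"
    then obtain q where "\<gamma> \<in> Z1 G Q a" "\<delta> \<in> Z1 G Q a" "q \<in> carrier Q"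
      and "\<forall>g\<in>carrier G. \<delta> g = a (inv\<^bsub>Q\<^esub> q) g \<otimes>\<^bsub>Q\<^esub> \<gamma> g \<otimes>\<^bsub>Q\<^esub> q"
      by (rule H1_relE)
    then show "(\<delta>, \<gamma>) \<in> H1_rel G Q a"
      by (intro H1_relI[where q = "inv\<^bsub>Q\<^esub> q"]) (simp_all add: act_simps Z1_closed Q_simps)
  qed
  show "trans (H1_rel G Q a)"
  proof (rule transI)
    fix \<gamma> \<delta> \<epsilon>
    assume *: "(\<gamma>, \<delta>) \<in> H1_rel G Q a" and **: "(\<delta>, \<epsilon>) \<in> H1_rel G Q a"
    obtain q where "\<gamma> \<in> Z1 G Q a" "\<delta> \<in> Z1 G Q a" "q \<in> carrier Q"
      and "\<forall>g\<in>carrier G. \<delta> g = a (inv\<^bsub>Q\<^esub> q) g \<otimes>\<^bsub>Q\<^esub> \<gamma> g \<otimes>\<^bsub>Q\<^esub> q"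
      using * by (rule H1_relE)
    moreover obtain q' where "\<epsilon> \<in> Z1 G Q a" "q' \<in> carrier Q"
      and "\<forall>g\<in>carrier G. \<epsilon> g = a (inv\<^bsub>Q\<^esub> q') g \<otimes>\<^bsub>Q\<^esub> \<delta> g \<otimes>\<^bsub>Q\<^esub> q'"
      using ** by (rule H1_relE)
    ultimately show "(\<gamma>, \<epsilon>) \<in> H1_rel G Q a"
      by (intro H1_relI[where q = "q \<otimes>\<^bsub>Q\<^esub> q'"]) (simp_all add: act_simps Z1_closed Q_simps)
  qed
qed

lemma H1_rel_refl: "\<gamma> \<in> Z1 G Q a \<Longrightarrow> (\<gamma>, \<gamma>) \<in> H1_rel G Q a"
  by (meson equivE equiv_H1_rel refl_onD)

lemma H1_class_eq_iff:
  "\<lbrakk>\<gamma> \<in> Z1 G Q a; \<delta> \<in> Z1 G Q a\<rbrakk>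
    \<Longrightarrow> H1_class G Q a \<gamma> = H1_class G Q a \<delta> \<longleftrightarrow> (\<gamma>, \<delta>) \<in> H1_rel G Q a"
  by (simp add: H1_class_def eq_equiv_class_iff[OF equiv_H1_rel])

lemma H1_class_eqI: "(\<gamma>, \<delta>) \<in> H1_rel G Q a \<Longrightarrow> H1_class G Q a \<gamma> = H1_class G Q a \<delta>"
  using H1_class_eq_iff H1_relD by blast

lemma H1_rel_sym: "(\<gamma>, \<delta>) \<in> H1_rel G Q a \<Longrightarrow> (\<delta>, \<gamma>) \<in> H1_rel G Q a"
  by (meson equivE equiv_H1_rel symD)

lemma H1_rel_trans:
  "\<lbrakk>(\<gamma>, \<delta>) \<in> H1_rel G Q a; (\<delta>, \<epsilon>) \<in> H1_rel G Q a\<rbrakk> \<Longrightarrow> (\<gamma>, \<epsilon>) \<in> H1_rel G Q a"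
  by (meson equivE equiv_H1_rel transD)

lemma H1_base_in: "H1_base G Q a \<in> H1 G Q a"
  by (simp add: H1_base_def H1_class_in_H1 trivial_cocycle)

text \<open>Maps out of \<open>H1\<close> are defined as unions over representatives. If
  \<open>f\<close> is constant on classes, all members contribute the same set and the union
  collapses to one value.\<close>

lemma UN_H1_class:
  assumes "\<And>\<gamma> \<delta>. (\<gamma>, \<delta>) \<in> H1_rel G Q a \<Longrightarrow> f \<gamma> = f \<delta>" "\<gamma> \<in> Z1 G Q a"
  shows "(\<Union>\<delta>\<in>H1_class G Q a \<gamma>. f \<delta>) = f \<gamma>"
  using assms unfolding H1_class_def
  by (intro UN_equiv_class[OF equiv_H1_rel]) (auto intro: congruentI)

lemma G_group_subgroup:
  assumes "subgroup B G"
  shows "G_group (G\<lparr>carrier := B\<rparr>) Q a"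
proof -
  have "B \<subseteq> carrier G" using assms by (rule subgroup.subset)
  then show ?thesis
    using G.subgroup_imp_group[OF assms]
    by (auto simp: G_group_def G_group_axioms_def Q.is_group intro!: act_hom act_one act_mult)
qed

lemma restrict_cocycle:
  assumes "subgroup B G" "\<gamma> \<in> Z1 G Q a"
  shows "restrict \<gamma> B \<in> Z1 (G\<lparr>carrier := B\<rparr>) Q a"
  using assms subgroup.mem_carrier[OF assms(1)] subgroup.m_closed[OF assms(1)]
  by (intro Z1I) (auto simp: Z1_closed Z1_mult)

lemma restrict_H1_rel:
  assumes "subgroup B G" "(\<gamma>, \<delta>) \<in> H1_rel G Q a"
  shows "(restrict \<gamma> B, restrict \<delta> B) \<in> H1_rel (G\<lparr>carrier := B\<rparr>) Q a"
  using assms(2)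
proof (rule H1_relE)
  fix q assume "\<gamma> \<in> Z1 G Q a" "\<delta> \<in> Z1 G Q a" "q \<in> carrier Q"
    and "\<forall>g\<in>carrier G. \<delta> g = a (inv\<^bsub>Q\<^esub> q) g \<otimes>\<^bsub>Q\<^esub> \<gamma> g \<otimes>\<^bsub>Q\<^esub> q"
  then show ?thesis
    using assms(1) subgroup.mem_carrier[OF assms(1)]
    by (intro H1_relI[where q = q] restrict_cocycle) auto
qed

lemma H1_res_class:
  assumes "subgroup B G" "\<gamma> \<in> Z1 G Q a"
  shows "H1_res G B Q a (H1_class G Q a \<gamma>) = H1_class (G\<lparr>carrier := B\<rparr>) Q a (restrict \<gamma> B)"
proof -
  interpret K: G_group "G\<lparr>carrier := B\<rparr>" Q a
    by (rule G_group_subgroup) fact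
  show ?thesis
    using assms unfolding H1_res_def by (intro UN_H1_class K.H1_class_eqI restrict_H1_rel)
qed

lemma H1_res_pointed:
  assumes "subgroup B G"
  shows "pointed_map (H1 G Q a) (H1_base G Q a)
    (H1 (G\<lparr>carrier := B\<rparr>) Q a) (H1_base (G\<lparr>carrier := B\<rparr>) Q a) (H1_res G B Q a)"
proof -
  interpret K: G_group "G\<lparr>carrier := B\<rparr>" Q a
    by (rule G_group_subgroup) fact
  have "H1_res G B Q a (H1_base G Q a) = H1_base (G\<lparr>carrier := B\<rparr>) Q a"
    using assms subgroup.subset[OF assms]
    by (simp add: H1_base_def H1_res_class trivial_cocycle Int_absorb1)
  moreover have "H1_res G B Q a \<in> H1 G Q a \<rightarrow> H1 (G\<lparr>carrier := B\<rparr>) Q a"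
    using assms by (auto elim!: H1E simp: H1_res_class intro!: H1_class_in_H1 restrict_cocycle)
  ultimately show ?thesis
    by (simp add: pointed_map_def H1_base_in K.H1_base_in)
qed

lemma one_in_H0: "\<one>\<^bsub>Q\<^esub> \<in> H0 G Q a"
  by (simp add: H0_def act_of_one)

end

section \<open>Functoriality of first cohomology in the coefficients\<close>

locale G_group_hom = Q: G_group G Q a + T: G_group G T b + group_hom Q T f
  for G :: "('g, 'x) monoid_scheme" and Q :: "('q, 'y) monoid_scheme" and a
    and T :: "('t, 'z) monoid_scheme" and b and f +
  assumes equivariant: "equivariant G Q a b f"
begin

lemma hom_act: "\<lbrakk>q \<in> carrier Q; g \<in> carrier G\<rbrakk> \<Longrightarrow> f (a q g) = b (f q) g"
  using equivariant by (simp add: equivariant_def)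

lemma map_cocycle: "\<gamma> \<in> Z1 G Q a \<Longrightarrow> (\<lambda>g\<in>carrier G. f (\<gamma> g)) \<in> Z1 G T b"
  by (intro Z1I) (auto simp: Z1_closed Z1_mult hom_act Q.act_closed)

lemma map_H1_rel:
  assumes "(\<gamma>, \<delta>) \<in> H1_rel G Q a"
  shows "(\<lambda>g\<in>carrier G. f (\<gamma> g), \<lambda>g\<in>carrier G. f (\<delta> g)) \<in> H1_rel G T b"
  using assms
proof (rule H1_relE)
  fix q assume *: "\<gamma> \<in> Z1 G Q a" "\<delta> \<in> Z1 G Q a" "q \<in> carrier Q"
    and "\<forall>g\<in>carrier G. \<delta> g = a (inv\<^bsub>Q\<^esub> q) g \<otimes>\<^bsub>Q\<^esub> \<gamma> g \<otimes>\<^bsub>Q\<^esub> q"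
  then show ?thesis
    by (intro H1_relI[where q = "f q"] map_cocycle)
      (auto simp: Z1_closed hom_act[symmetric] Q.act_closed hom_inv[symmetric] simp del: hom_inv)
qed

lemma H1_map_class:
  "\<gamma> \<in> Z1 G Q a \<Longrightarrow> H1_map G T b f (H1_class G Q a \<gamma>) = H1_class G T b (\<lambda>g\<in>carrier G. f (\<gamma> g))"
  unfolding H1_map_def by (intro Q.UN_H1_class T.H1_class_eqI map_H1_rel)

lemma H1_map_pointed:
  "pointed_map (H1 G Q a) (H1_base G Q a) (H1 G T b) (H1_base G T b) (H1_map G T b f)"
proof -
  have "H1_map G T b f (H1_base G Q a) = H1_base G T b"
    by (simp add: H1_base_def H1_map_class Q.trivial_cocycle cong: restrict_cong)
  moreover have "H1_map G T b f \<in> H1 G Q a \<rightarrow> H1 G T b"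
    by (auto elim!: H1E simp: H1_map_class intro!: H1_class_in_H1 map_cocycle)
  ultimately show ?thesis
    by (simp add: pointed_map_def Q.H1_base_in T.H1_base_in)
qed

lemma G_group_hom_subgroup: "subgroup B G \<Longrightarrow> G_group_hom (G\<lparr>carrier := B\<rparr>) Q a T b f"
  using equivariant subgroup.subset[of B G]
  by (auto simp: G_group_hom_def G_group_hom_axioms_def Q.G_group_subgroup T.G_group_subgroup
    group_hom_axioms equivariant_def)

lemma H1_res_map:
  assumes "subgroup B G" "c \<in> H1 G Q a"
  shows "H1_res G B T b (H1_map G T b f c) =
    H1_map (G\<lparr>carrier := B\<rparr>) T b f (H1_res G B Q a c)"
proof -
  interpret K: G_group_hom "G\<lparr>carrier := B\<rparr>" Q a T b f
    by (rule G_group_hom_subgroup) fact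
  obtain \<gamma> where \<gamma>: "\<gamma> \<in> Z1 G Q a" "c = H1_class G Q a \<gamma>"
    using assms(2) by (rule H1E)
  have "restrict (\<lambda>g\<in>carrier G. f (\<gamma> g)) B = (\<lambda>g\<in>B. f (restrict \<gamma> B g))"
    using subgroup.mem_carrier[OF assms(1)] by auto
  then show ?thesis
    using \<gamma> assms(1) K.H1_map_class[OF Q.restrict_cocycle]
    by (simp add: H1_map_class Q.H1_res_class T.H1_res_class map_cocycle)
qed

end

section \<open>Second cohomology of abelian groups\<close>

lemma Z2I:
  assumes "\<gamma> \<in> carrier G \<times> carrier G \<rightarrow>\<^sub>E carrier R"
    and "\<And>g h k. \<lbrakk>g \<in> carrier G; h \<in> carrier G; k \<in> carrier G\<rbrakk>
      \<Longrightarrow> \<gamma> (g \<otimes>\<^bsub>G\<^esub> h, k) \<otimes>\<^bsub>R\<^esub> a (\<gamma> (g, h)) k = \<gamma> (g, h \<otimes>\<^bsub>G\<^esub> k) \<otimes>\<^bsub>R\<^esub> \<gamma> (h, k)"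
  shows "\<gamma> \<in> Z2 G R a"
  using assms by (simp add: Z2_def)

lemma Z2_closed:
  "\<lbrakk>\<gamma> \<in> Z2 G R a; g \<in> carrier G; h \<in> carrier G\<rbrakk> \<Longrightarrow> \<gamma> (g, h) \<in> carrier R"
  by (auto simp: Z2_def)

locale abelian_G_group = G_group G R a + R: comm_group R
  for G :: "('g, 'x) monoid_scheme" and R :: "('r, 'y) monoid_scheme" and a
begin

text \<open>The factor by which \<open>H2_rel\<close> alters a cocycle, isolated because it is
  multiplicative in \<phi>.\<close>

definition coboundary :: "('g \<Rightarrow> 'r) \<Rightarrow> 'g \<Rightarrow> 'g \<Rightarrow> 'r" where
  "coboundary \<phi> g h = a (\<phi> g) h \<otimes>\<^bsub>R\<^esub> \<phi> h \<otimes>\<^bsub>R\<^esub> inv\<^bsub>R\<^esub> (\<phi> (g \<otimes>\<^bsub>G\<^esub> h))"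

lemma coboundary_closed:
  "\<lbrakk>\<phi> \<in> carrier G \<rightarrow> carrier R; g \<in> carrier G; h \<in> carrier G\<rbrakk>
    \<Longrightarrow> coboundary \<phi> g h \<in> carrier R"
  by (auto simp: coboundary_def act_simps Pi_iff)

lemma H2_rel_iff:
  "(\<gamma>, \<delta>) \<in> H2_rel G R a \<longleftrightarrow> \<gamma> \<in> Z2 G R a \<and> \<delta> \<in> Z2 G R a \<and>
    (\<exists>\<phi>\<in>carrier G \<rightarrow> carrier R. \<forall>g\<in>carrier G. \<forall>h\<in>carrier G.
      \<delta> (g, h) = \<gamma> (g, h) \<otimes>\<^bsub>R\<^esub> coboundary \<phi> g h)"
  unfolding H2_rel_def coboundary_def
  by (auto simp: Pi_iff Z2_closed act_simps Q.m_assoc intro!: conj_cong bex_cong)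

lemma trivial_Z2: "(\<lambda>x\<in>carrier G \<times> carrier G. \<one>\<^bsub>R\<^esub>) \<in> Z2 G R a"
  by (rule Z2I) (auto simp: act_simps)

text \<open>As \<open>R\<close> is abelian, taking coboundaries is a homomorphism on 1-cochains. The
  constant cochain 1, the pointwise inverse and the pointwise product are therefore the
  witnesses.\<close>

lemma equiv_H2_rel: "equiv (Z2 G R a) (H2_rel G R a)"
proof (rule equivI)
  show "H2_rel G R a \<subseteq> Z2 G R a \<times> Z2 G R a"
    by (auto simp: H2_rel_def)
  show "refl_on (Z2 G R a) (H2_rel G R a)"
  proof (rule refl_onI)
    fix \<gamma> assume "\<gamma> \<in> Z2 G R a"
    then show "(\<gamma>, \<gamma>) \<in> H2_rel G R a"
      unfolding H2_rel_iff
      by (auto simp: coboundary_def act_simps Z2_closed intro!: bexI[where x = "\<lambda>_. \<one>\<^bsub>R\<^esub>"])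
  qed
  show "sym (H2_rel G R a)"
  proof (rule symI)
    fix \<gamma> \<delta> assume *: "(\<gamma>, \<delta>) \<in> H2_rel G R a"
    then obtain \<phi> where \<phi>: "\<phi> \<in> carrier G \<rightarrow> carrier R"
      "\<forall>g\<in>carrier G. \<forall>h\<in>carrier G. \<delta> (g, h) = \<gamma> (g, h) \<otimes>\<^bsub>R\<^esub> coboundary \<phi> g h"
      unfolding H2_rel_iff by blast
    have "coboundary (\<lambda>g. inv\<^bsub>R\<^esub> (\<phi> g)) g h = inv\<^bsub>R\<^esub> (coboundary \<phi> g h)"
      if "g \<in> carrier G" "h \<in> carrier G" for g h
      using that \<phi>(1) by (simp add: Pi_iff coboundary_def act_simps R.inv_mult)
    with * \<phi> show "(\<delta>, \<gamma>) \<in> H2_rel G R a"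
      unfolding H2_rel_iff
      by (auto simp: Z2_closed coboundary_closed Q.m_assoc
          intro!: bexI[where x = "\<lambda>g. inv\<^bsub>R\<^esub> (\<phi> g)"])
  qed
  show "trans (H2_rel G R a)"
  proof (rule transI)
    fix \<gamma> \<delta> \<epsilon>
    assume *: "(\<gamma>, \<delta>) \<in> H2_rel G R a" and **: "(\<delta>, \<epsilon>) \<in> H2_rel G R a"
    from * obtain \<phi> where \<phi>: "\<phi> \<in> carrier G \<rightarrow> carrier R"
      "\<forall>g\<in>carrier G. \<forall>h\<in>carrier G. \<delta> (g, h) = \<gamma> (g, h) \<otimes>\<^bsub>R\<^esub> coboundary \<phi> g h"
      unfolding H2_rel_iff by blast
    from ** obtain \<psi> where \<psi>: "\<psi> \<in> carrier G \<rightarrow> carrier R"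
      "\<forall>g\<in>carrier G. \<forall>h\<in>carrier G. \<epsilon> (g, h) = \<delta> (g, h) \<otimes>\<^bsub>R\<^esub> coboundary \<psi> g h"
      unfolding H2_rel_iff by blast
    have "coboundary (\<lambda>g. \<phi> g \<otimes>\<^bsub>R\<^esub> \<psi> g) g h = coboundary \<phi> g h \<otimes>\<^bsub>R\<^esub> coboundary \<psi> g h"
      if "g \<in> carrier G" "h \<in> carrier G" for g h
      using that \<phi>(1) \<psi>(1) by (simp add: Pi_iff coboundary_def act_simps R.inv_mult R.m_ac)
    with * ** \<phi> \<psi> show "(\<gamma>, \<epsilon>) \<in> H2_rel G R a"
      unfolding H2_rel_iff
      by (auto simp: Z2_closed coboundary_closed Q.m_assoc
          intro!: bexI[where x = "\<lambda>g. \<phi> g \<otimes>\<^bsub>R\<^esub> \<psi> g"])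
  qed
qed

lemma H2_class_eq_iff:
  "\<lbrakk>\<gamma> \<in> Z2 G R a; \<delta> \<in> Z2 G R a\<rbrakk>
    \<Longrightarrow> H2_class G R a \<gamma> = H2_class G R a \<delta> \<longleftrightarrow> (\<gamma>, \<delta>) \<in> H2_rel G R a"
  by (simp add: H2_class_def eq_equiv_class_iff[OF equiv_H2_rel])

lemma H2_class_eqI: "(\<gamma>, \<delta>) \<in> H2_rel G R a \<Longrightarrow> H2_class G R a \<gamma> = H2_class G R a \<delta>"
  using H2_class_eq_iff H2_rel_iff by blast

lemma H2_base_in: "H2_base G R a \<in> H2 G R a"
  by (simp add: H2_base_def H2_class_in_H2 trivial_Z2)

lemma abelian_G_group_subgroup: "subgroup B G \<Longrightarrow> abelian_G_group (G\<lparr>carrier := B\<rparr>) R a"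
  by (simp add: abelian_G_group_def G_group_subgroup R.comm_group_axioms)

lemma restrict_Z2:
  assumes "subgroup B G" "\<gamma> \<in> Z2 G R a"
  shows "restrict \<gamma> (B \<times> B) \<in> Z2 (G\<lparr>carrier := B\<rparr>) R a"
  using assms subgroup.mem_carrier[OF assms(1)] subgroup.m_closed[OF assms(1)]
  by (intro Z2I) (auto simp: Z2_def)

text \<open>A cochain relating two cocycles over \<open>G\<close> also relates their restrictions,
  since the coboundary formula is the same over \<open>B\<close>.\<close>

lemma H2_res_class:
  assumes B: "subgroup B G" and \<gamma>: "\<gamma> \<in> Z2 G R a"
  shows "H2_res G B R a (H2_class G R a \<gamma>) =
    H2_class (G\<lparr>carrier := B\<rparr>) R a (restrict \<gamma> (B \<times> B))"
proof -
  interpret K: abelian_G_group "G\<lparr>carrier := B\<rparr>" R a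
    using B by (rule abelian_G_group_subgroup)
  have "(restrict \<delta> (B \<times> B), restrict \<epsilon> (B \<times> B)) \<in> H2_rel (G\<lparr>carrier := B\<rparr>) R a"
    if "(\<delta>, \<epsilon>) \<in> H2_rel G R a" for \<delta> \<epsilon>
    using that restrict_Z2[OF B] subgroup.mem_carrier[OF B]
    unfolding H2_rel_iff K.H2_rel_iff coboundary_def K.coboundary_def
    by (auto simp: subgroup.m_closed[OF B] Pi_iff)
  with \<gamma> show ?thesis
    unfolding H2_res_def H2_class_def[of G]
    by (intro UN_equiv_class[OF equiv_H2_rel]) (auto intro!: congruentI K.H2_class_eqI)
qed

lemma H2_res_pointed:
  assumes "subgroup B G"
  shows "pointed_map (H2 G R a) (H2_base G R a)
    (H2 (G\<lparr>carrier := B\<rparr>) R a) (H2_base (G\<lparr>carrier := B\<rparr>) R a) (H2_res G B R a)"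
proof -
  interpret K: abelian_G_group "G\<lparr>carrier := B\<rparr>" R a
    using assms by (rule abelian_G_group_subgroup)
  have "H2_res G B R a (H2_base G R a) = H2_base (G\<lparr>carrier := B\<rparr>) R a"
    using assms subgroup.subset[OF assms]
    by (simp add: H2_base_def H2_res_class trivial_Z2 Int_absorb1 Times_Int_Times)
  moreover have "H2_res G B R a \<in> H2 G R a \<rightarrow> H2 (G\<lparr>carrier := B\<rparr>) R a"
    using assms by (auto elim!: H2E simp: H2_res_class intro!: H2_class_in_H2 restrict_Z2)
  ultimately show ?thesis
    by (simp add: pointed_map_def H2_base_in K.H2_base_in)
qed

end

section \<open>The exact sequence of a central extension\<close>

text \<open>Exactness is encoded by injectivity of \<open>i\<close> and by its image being the
  kernel of \<open>p\<close>; surjectivity of \<open>p\<close> is carried by the section \<sigma>,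
  which is only a map of sets.\<close>

locale central_extension = R: G_group G R aR + Q: G_group G Q aQ + S: G_group G S aS +
  i: G_group_hom G R aR Q aQ i + p: G_group_hom G Q aQ S aS p
  for G :: "('g, 'x) monoid_scheme"
    and R :: "('r, 'u) monoid_scheme" and aR :: "'r \<Rightarrow> 'g \<Rightarrow> 'r"
    and Q :: "('q, 'v) monoid_scheme" and aQ :: "'q \<Rightarrow> 'g \<Rightarrow> 'q"
    and S :: "('s, 'w) monoid_scheme" and aS :: "'s \<Rightarrow> 'g \<Rightarrow> 's"
    and i :: "'r \<Rightarrow> 'q" and p :: "'q \<Rightarrow> 's" and \<sigma> :: "'s \<Rightarrow> 'q" +
  assumes inj_i: "inj_on i (carrier R)"
    and image_i: "i ` carrier R = kernel Q S p"
    and central_i: "i ` carrier R \<subseteq> group_center Q"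
    and section_closed: "s \<in> carrier S \<Longrightarrow> \<sigma> s \<in> carrier Q"
    and p_section: "s \<in> carrier S \<Longrightarrow> p (\<sigma> s) = s"
begin

lemma i_eq_iff: "\<lbrakk>r \<in> carrier R; r' \<in> carrier R\<rbrakk> \<Longrightarrow> i r = i r' \<longleftrightarrow> r = r'"
  using inj_i by (auto dest: inj_onD)

lemma p_i: "r \<in> carrier R \<Longrightarrow> p (i r) = \<one>\<^bsub>S\<^esub>"
  using image_i by (auto simp: kernel_def)

lemma commute: "\<lbrakk>r \<in> carrier R; q \<in> carrier Q\<rbrakk> \<Longrightarrow> q \<otimes>\<^bsub>Q\<^esub> i r = i r \<otimes>\<^bsub>Q\<^esub> q"
  using central_i by (auto simp: group_center_def)

lemma left_commute:
  "\<lbrakk>r \<in> carrier R; q \<in> carrier Q; x \<in> carrier Q\<rbrakk>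
    \<Longrightarrow> q \<otimes>\<^bsub>Q\<^esub> (i r \<otimes>\<^bsub>Q\<^esub> x) = i r \<otimes>\<^bsub>Q\<^esub> (q \<otimes>\<^bsub>Q\<^esub> x)"
  by (simp add: commute flip: Q.Q.m_assoc)

text \<open>The injection \<open>i\<close> reflects commutativity, and its image is central in
  \<open>Q\<close>.\<close>

sublocale R: abelian_G_group G R aR
proof
  fix x y assume "x \<in> carrier R" "y \<in> carrier R"
  then show "x \<otimes>\<^bsub>R\<^esub> y = y \<otimes>\<^bsub>R\<^esub> x"
    using commute[of x "i y"] by (simp add: i_eq_iff flip: i.hom_mult)
qed

text \<open>On the kernel of \<open>p\<close> this undoes the identification of \<open>R\<close>
  with its image; elsewhere the value has no meaning.\<close>

abbreviation j :: "'q \<Rightarrow> 'r" where "j \<equiv> inv_into (carrier R) i"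

lemma j:
  assumes "x \<in> carrier Q" "p x = \<one>\<^bsub>S\<^esub>"
  shows "j x \<in> carrier R" and "i (j x) = x"
proof -
  have "x \<in> i ` carrier R"
    using assms by (simp add: image_i kernel_def)
  then show "j x \<in> carrier R" and "i (j x) = x"
    by (simp_all add: inv_into_into f_inv_into_f)
qed

lemma p_eqE:
  assumes "x \<in> carrier Q" "y \<in> carrier Q" "p x = p y"
  obtains r where "r \<in> carrier R" "y = x \<otimes>\<^bsub>Q\<^esub> i r"
proof
  have "p (inv\<^bsub>Q\<^esub> x \<otimes>\<^bsub>Q\<^esub> y) = \<one>\<^bsub>S\<^esub>"
    using assms by simp
  then show "j (inv\<^bsub>Q\<^esub> x \<otimes>\<^bsub>Q\<^esub> y) \<in> carrier R"
    and "y = x \<otimes>\<^bsub>Q\<^esub> i (j (inv\<^bsub>Q\<^esub> x \<otimes>\<^bsub>Q\<^esub> y))"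
    using assms by (simp_all add: j Q.Q_simps)
qed

text \<open>Two cochains with the same image in \<open>S\<close> differ by a cochain in the kernel,
  with one element of \<open>R\<close> chosen for each \<open>g\<close>.\<close>

lemma p_eq_cochainE:
  assumes "\<And>g. g \<in> carrier G \<Longrightarrow> u g \<in> carrier Q" "\<And>g. g \<in> carrier G \<Longrightarrow> v g \<in> carrier Q"
    and "\<And>g. g \<in> carrier G \<Longrightarrow> p (u g) = p (v g)"
  obtains \<phi> where "\<phi> \<in> carrier G \<rightarrow>\<^sub>E carrier R"
    and "\<And>g. g \<in> carrier G \<Longrightarrow> v g = u g \<otimes>\<^bsub>Q\<^esub> i (\<phi> g)"
proof -
  have "\<forall>g\<in>carrier G. \<exists>r. r \<in> carrier R \<and> v g = u g \<otimes>\<^bsub>Q\<^esub> i r"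
    using assms by (metis p_eqE)
  then obtain \<phi> where "\<forall>g\<in>carrier G. \<phi> g \<in> carrier R \<and> v g = u g \<otimes>\<^bsub>Q\<^esub> i (\<phi> g)"
    by metis
  then show thesis
    \<comment> \<open>Restricting the chosen function makes it extensional, as membership in
      \<open>Z1\<close> will demand.\<close>
    by (intro that[of "restrict \<phi> (carrier G)"]) auto
qed

section \<open>Translation: 1-cocycles of \<open>R\<close> acting on 1-cocycles of
  \<open>Q\<close>\<close>

definition translate :: "('g \<Rightarrow> 'q) \<Rightarrow> ('g \<Rightarrow> 'r) \<Rightarrow> 'g \<Rightarrow> 'q" where
  "translate \<gamma> \<rho> = (\<lambda>g\<in>carrier G. \<gamma> g \<otimes>\<^bsub>Q\<^esub> i (\<rho> g))"

text \<open>By equivariance the factor of \<rho>(g) moved by \<open>h\<close> still comes from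
  \<open>R\<close>, so it passes \<gamma>(h) and the two cocycle identities multiply.\<close>

lemma translate_cocycle:
  assumes "\<gamma> \<in> Z1 G Q aQ" "\<rho> \<in> Z1 G R aR"
  shows "translate \<gamma> \<rho> \<in> Z1 G Q aQ"
proof (rule Z1I)
  show "translate \<gamma> \<rho> \<in> carrier G \<rightarrow>\<^sub>E carrier Q"
    using assms by (auto simp: translate_def Z1_closed)
  fix g h assume gh: "g \<in> carrier G" "h \<in> carrier G"
  with assms show "translate \<gamma> \<rho> (g \<otimes>\<^bsub>G\<^esub> h) =
      aQ (translate \<gamma> \<rho> g) h \<otimes>\<^bsub>Q\<^esub> translate \<gamma> \<rho> h"
    using left_commute[of "aR (\<rho> g) h" "\<gamma> h" "i (\<rho> h)"]
    by (simp add: translate_def Z1_closed Z1_mult Q.act_simps R.act_simps Q.Q_simps flip: i.hom_act)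
qed

text \<open>Expand \<delta>(gh) once through the product law of \<gamma> and once through that of
  \<delta>, collect the central factors, then cancel the values of \<gamma> and apply injectivity of
  \<open>i\<close>.\<close>

lemma cocycle_of_translate:
  assumes "\<gamma> \<in> Z1 G Q aQ" "\<delta> \<in> Z1 G Q aQ" "\<rho> \<in> carrier G \<rightarrow>\<^sub>E carrier R"
    and \<delta>: "\<And>g. g \<in> carrier G \<Longrightarrow> \<delta> g = \<gamma> g \<otimes>\<^bsub>Q\<^esub> i (\<rho> g)"
  shows "\<rho> \<in> Z1 G R aR"
proof (rule Z1I)
  fix g h assume gh: "g \<in> carrier G" "h \<in> carrier G"
  then have \<rho>: "\<rho> g \<in> carrier R" "\<rho> h \<in> carrier R" "\<rho> (g \<otimes>\<^bsub>G\<^esub> h) \<in> carrier R"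
    using assms(3) by auto
  have "aQ (\<gamma> g) h \<otimes>\<^bsub>Q\<^esub> (\<gamma> h \<otimes>\<^bsub>Q\<^esub> i (\<rho> (g \<otimes>\<^bsub>G\<^esub> h))) = \<delta> (g \<otimes>\<^bsub>G\<^esub> h)"
    using assms(1) gh \<rho> by (simp add: \<delta> Z1_mult Z1_closed Q.act_simps Q.Q_simps)
  also have "\<dots> = aQ (\<gamma> g \<otimes>\<^bsub>Q\<^esub> i (\<rho> g)) h \<otimes>\<^bsub>Q\<^esub> (\<gamma> h \<otimes>\<^bsub>Q\<^esub> i (\<rho> h))"
    using assms(2) gh by (simp add: Z1_mult \<delta>[symmetric])
  also have "\<dots> = aQ (\<gamma> g) h \<otimes>\<^bsub>Q\<^esub> (\<gamma> h \<otimes>\<^bsub>Q\<^esub> i (aR (\<rho> g) h \<otimes>\<^bsub>R\<^esub> \<rho> h))"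
    using assms(1) gh \<rho> left_commute[of "aR (\<rho> g) h" "\<gamma> h" "i (\<rho> h)"]
    by (simp add: Z1_closed Q.act_simps R.act_simps Q.Q_simps flip: i.hom_act)
  finally show "\<rho> (g \<otimes>\<^bsub>G\<^esub> h) = aR (\<rho> g) h \<otimes>\<^bsub>R\<^esub> \<rho> h"
    using assms(1) gh \<rho> by (simp add: Z1_closed Q.act_simps R.act_simps i_eq_iff del: i.hom_mult)
qed fact

text \<open>If \<open>r\<close> conjugates \<rho> to \<rho>', then \<open>i r\<close> conjugates the
  translates, as its moved inverse passes \<gamma>(g). With the next lemma, translation is well
  defined on classes in both arguments.\<close>

lemma translate_rel_right:
  assumes "\<gamma> \<in> Z1 G Q aQ" "(\<rho>, \<rho>') \<in> H1_rel G R aR"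
  shows "(translate \<gamma> \<rho>, translate \<gamma> \<rho>') \<in> H1_rel G Q aQ"
  using assms(2)
proof (rule H1_relE)
  fix r assume *: "\<rho> \<in> Z1 G R aR" "\<rho>' \<in> Z1 G R aR" "r \<in> carrier R"
    and **: "\<forall>g\<in>carrier G. \<rho>' g = aR (inv\<^bsub>R\<^esub> r) g \<otimes>\<^bsub>R\<^esub> \<rho> g \<otimes>\<^bsub>R\<^esub> r"
  show ?thesis
  proof (rule H1_relI)
    show "i r \<in> carrier Q" using * by simp
    fix g assume g: "g \<in> carrier G"
    then show "translate \<gamma> \<rho>' g = aQ (inv\<^bsub>Q\<^esub> i r) g \<otimes>\<^bsub>Q\<^esub> translate \<gamma> \<rho> g \<otimes>\<^bsub>Q\<^esub> i r"
      using * ** assms(1) left_commute[of "aR (inv\<^bsub>R\<^esub> r) g" "\<gamma> g" "i (\<rho> g) \<otimes>\<^bsub>Q\<^esub> i r"]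
      by (simp add: translate_def Z1_closed R.act_closed Q.Q_simps
          flip: i.hom_act i.hom_inv)
  qed (use assms(1) * translate_cocycle in auto)
qed

text \<open>The same \<open>q\<close> still conjugates, since the central factor moves past
  it.\<close>

lemma translate_rel_left:
  assumes "(\<gamma>, \<gamma>') \<in> H1_rel G Q aQ" "\<rho> \<in> Z1 G R aR"
  shows "(translate \<gamma> \<rho>, translate \<gamma>' \<rho>) \<in> H1_rel G Q aQ"
  using assms(1)
proof (rule H1_relE)
  fix q assume *: "\<gamma> \<in> Z1 G Q aQ" "\<gamma>' \<in> Z1 G Q aQ" "q \<in> carrier Q"
    and **: "\<forall>g\<in>carrier G. \<gamma>' g = aQ (inv\<^bsub>Q\<^esub> q) g \<otimes>\<^bsub>Q\<^esub> \<gamma> g \<otimes>\<^bsub>Q\<^esub> q"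
  show ?thesis
  proof (rule H1_relI)
    fix g assume g: "g \<in> carrier G"
    then show "translate \<gamma>' \<rho> g = aQ (inv\<^bsub>Q\<^esub> q) g \<otimes>\<^bsub>Q\<^esub> translate \<gamma> \<rho> g \<otimes>\<^bsub>Q\<^esub> q"
      using * ** assms(2) commute[of "\<rho> g" q]
      by (simp add: translate_def Z1_closed Q.act_closed Q.Q.m_assoc)
  qed (use assms(2) * translate_cocycle in auto)
qed

text \<open>Transitivity of translation on the fibres over first cohomology of \<open>S\<close>.
  Conjugating \<gamma> by a lift of the element relating the two images makes these images equal
  pointwise; what remains between the cocycles lies in \<open>R\<close>.\<close>

lemma fibre_translate:
  assumes "\<gamma> \<in> Z1 G Q aQ" "\<delta> \<in> Z1 G Q aQ"
    and "(\<lambda>g\<in>carrier G. p (\<gamma> g), \<lambda>g\<in>carrier G. p (\<delta> g)) \<in> H1_rel G S aS"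
  obtains \<rho> where "\<rho> \<in> Z1 G R aR" "(translate \<gamma> \<rho>, \<delta>) \<in> H1_rel G Q aQ"
proof -
  obtain s where s: "s \<in> carrier S"
    and eq: "\<forall>g\<in>carrier G. (\<lambda>g\<in>carrier G. p (\<delta> g)) g =
      aS (inv\<^bsub>S\<^esub> s) g \<otimes>\<^bsub>S\<^esub> (\<lambda>g\<in>carrier G. p (\<gamma> g)) g \<otimes>\<^bsub>S\<^esub> s"
    using assms(3) by (rule H1_relE)
  define \<gamma>' where "\<gamma>' = (\<lambda>g\<in>carrier G. aQ (inv\<^bsub>Q\<^esub> \<sigma> s) g \<otimes>\<^bsub>Q\<^esub> \<gamma> g \<otimes>\<^bsub>Q\<^esub> \<sigma> s)"
  have \<gamma>': "(\<gamma>, \<gamma>') \<in> H1_rel G Q aQ" "\<gamma>' \<in> Z1 G Q aQ"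
    unfolding \<gamma>'_def using assms(1) s
    by (simp_all add: Q.conj_cocycle_rel Q.conj_cocycle section_closed)
  have "p (\<gamma>' g) = p (\<delta> g)" if "g \<in> carrier G" for g
    using that s eq assms(1)
    by (simp add: \<gamma>'_def p_section section_closed Z1_closed Q.act_closed p.hom_act)
  then obtain \<rho> where \<rho>: "\<rho> \<in> carrier G \<rightarrow>\<^sub>E carrier R"
    "\<And>g. g \<in> carrier G \<Longrightarrow> \<delta> g = \<gamma>' g \<otimes>\<^bsub>Q\<^esub> i (\<rho> g)"
    using p_eq_cochainE[of \<gamma>' \<delta>] \<gamma>'(2) assms(2) Z1_closed by metis
  then have Z: "\<rho> \<in> Z1 G R aR"
    using cocycle_of_translate \<gamma>'(2) assms(2) by blast
  moreover have "\<delta> = translate \<gamma>' \<rho>"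
    by (rule Z1_eqI[OF assms(2) translate_cocycle[OF \<gamma>'(2) Z]]) (simp add: translate_def \<rho>(2))
  ultimately show thesis
    using that translate_rel_left[OF \<gamma>'(1)] by blast
qed

section \<open>The connecting map in degree 0, computed from arbitrary lifts\<close>

definition difference :: "'q \<Rightarrow> 'g \<Rightarrow> 'r" where
  "difference q = (\<lambda>g\<in>carrier G. j (aQ (inv\<^bsub>Q\<^esub> q) g \<otimes>\<^bsub>Q\<^esub> q))"

lemma difference_value:
  assumes "q \<in> carrier Q" "p q \<in> H0 G S aS" "g \<in> carrier G"
  shows "difference q g \<in> carrier R" and "i (difference q g) = aQ (inv\<^bsub>Q\<^esub> q) g \<otimes>\<^bsub>Q\<^esub> q"
proof -
  have "p (aQ (inv\<^bsub>Q\<^esub> q) g \<otimes>\<^bsub>Q\<^esub> q) = \<one>\<^bsub>S\<^esub>"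
    using assms by (simp add: Q.act_closed p.hom_act S.act_inv H0_def)
  then show "difference q g \<in> carrier R" and "i (difference q g) = aQ (inv\<^bsub>Q\<^esub> q) g \<otimes>\<^bsub>Q\<^esub> q"
    using assms by (simp_all add: difference_def j Q.act_closed)
qed

text \<open>The map sending \<open>g\<close> to q^(-g) q is the trivial cocycle of \<open>Q\<close>
  conjugated by \<open>q\<close>. It is also the trivial cocycle multiplied by a cochain in
  \<open>R\<close>, so \<open>cocycle_of_translate\<close> applies.\<close>

lemma difference_cocycle:
  assumes "q \<in> carrier Q" "p q \<in> H0 G S aS"
  shows "difference q \<in> Z1 G R aR"
proof (rule cocycle_of_translate)
  show "(\<lambda>g\<in>carrier G. \<one>\<^bsub>Q\<^esub>) \<in> Z1 G Q aQ"
    by (rule Q.trivial_cocycle)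
  then show "(\<lambda>g\<in>carrier G. aQ (inv\<^bsub>Q\<^esub> q) g \<otimes>\<^bsub>Q\<^esub> (\<lambda>g\<in>carrier G. \<one>\<^bsub>Q\<^esub>) g \<otimes>\<^bsub>Q\<^esub> q) \<in> Z1 G Q aQ"
    using assms(1) by (rule Q.conj_cocycle)
  show "difference q \<in> carrier G \<rightarrow>\<^sub>E carrier R"
    using difference_value(1)[OF assms] by (auto simp: difference_def)
qed (use assms in \<open>simp add: difference_value Q.act_closed\<close>)

text \<open>Multiplying the lift by the central element \<open>i r\<close> conjugates the cocycle by
  \<open>r\<close>.\<close>

lemma difference_rel:
  assumes "q \<in> carrier Q" "p q \<in> H0 G S aS" "r \<in> carrier R"
  shows "(difference q, difference (q \<otimes>\<^bsub>Q\<^esub> i r)) \<in> H1_rel G R aR"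
proof (rule H1_relI)
  have pq: "p (q \<otimes>\<^bsub>Q\<^esub> i r) \<in> H0 G S aS"
    using assms by (simp add: p_i)
  show "difference q \<in> Z1 G R aR" "difference (q \<otimes>\<^bsub>Q\<^esub> i r) \<in> Z1 G R aR"
    using assms pq by (simp_all add: difference_cocycle del: p.hom_mult)
  fix g assume g: "g \<in> carrier G"
  have "i (difference (q \<otimes>\<^bsub>Q\<^esub> i r) g) =
      i (aR (inv\<^bsub>R\<^esub> r) g \<otimes>\<^bsub>R\<^esub> difference q g \<otimes>\<^bsub>R\<^esub> r)"
    using assms g pq
    by (simp add: difference_value Q.act_simps R.act_simps Q.Q_simps i.hom_act del: p.hom_mult)
  then show "difference (q \<otimes>\<^bsub>Q\<^esub> i r) g = aR (inv\<^bsub>R\<^esub> r) g \<otimes>\<^bsub>R\<^esub> difference q g \<otimes>\<^bsub>R\<^esub> r"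
    using assms g pq
    by (simp add: difference_value(1) R.act_closed i_eq_iff del: p.hom_mult i.hom_mult)
qed fact

text \<open>The lift chosen by \<sigma> and the lift \<open>q\<close> differ by an element of
  \<open>R\<close>, so the class does not depend on the section.\<close>

lemma connecting0_class:
  assumes "q \<in> carrier Q" "p q \<in> H0 G S aS"
  shows "connecting0 G R aR Q aQ i \<sigma> (p q) = H1_class G R aR (difference q)"
proof -
  obtain r where "r \<in> carrier R" "\<sigma> (p q) = q \<otimes>\<^bsub>Q\<^esub> i r"
    using assms(1) p_eqE[of q "\<sigma> (p q)"] by (auto simp: p_section section_closed)
  then show ?thesis
    using R.H1_class_eqI[OF difference_rel[OF assms]]
    by (simp add: connecting0_def flip: difference_def)
qed

section \<open>The obstruction to lifting a cocycle from \<open>S\<close> to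
  \<open>Q\<close>\<close>

definition lifts :: "('g \<Rightarrow> 's) \<Rightarrow> ('g \<Rightarrow> 'q) \<Rightarrow> bool" where
  "lifts \<gamma> u \<longleftrightarrow> (\<forall>g\<in>carrier G. u g \<in> carrier Q \<and> p (u g) = \<gamma> g)"

text \<open>The factor set of the cochain \<open>u\<close>. For the lift given by \<sigma> it is the
  2-cocycle in \<open>connecting1\<close>; general lifts are allowed so that they can be
  compared.\<close>

definition obstruction :: "('g \<Rightarrow> 'q) \<Rightarrow> 'g \<times> 'g \<Rightarrow> 'r" where
  "obstruction u = (\<lambda>(g, h)\<in>carrier G \<times> carrier G.
    j (aQ (u g) h \<otimes>\<^bsub>Q\<^esub> u h \<otimes>\<^bsub>Q\<^esub> inv\<^bsub>Q\<^esub> (u (g \<otimes>\<^bsub>G\<^esub> h))))"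

lemma obstruction_value:
  assumes "\<gamma> \<in> Z1 G S aS" "lifts \<gamma> u" "g \<in> carrier G" "h \<in> carrier G"
  shows "obstruction u (g, h) \<in> carrier R"
    and "aQ (u g) h \<otimes>\<^bsub>Q\<^esub> u h = i (obstruction u (g, h)) \<otimes>\<^bsub>Q\<^esub> u (g \<otimes>\<^bsub>G\<^esub> h)"
proof -
  have u: "u g \<in> carrier Q" "u h \<in> carrier Q" "u (g \<otimes>\<^bsub>G\<^esub> h) \<in> carrier Q"
    "p (u g) = \<gamma> g" "p (u h) = \<gamma> h" "p (u (g \<otimes>\<^bsub>G\<^esub> h)) = \<gamma> (g \<otimes>\<^bsub>G\<^esub> h)"
    using assms by (auto simp: lifts_def)
  then have "p (aQ (u g) h \<otimes>\<^bsub>Q\<^esub> u h \<otimes>\<^bsub>Q\<^esub> inv\<^bsub>Q\<^esub> (u (g \<otimes>\<^bsub>G\<^esub> h))) = \<one>\<^bsub>S\<^esub>"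
    using assms by (simp add: Q.act_closed S.act_closed p.hom_act Z1_mult Z1_closed)
  then show "obstruction u (g, h) \<in> carrier R"
    and "aQ (u g) h \<otimes>\<^bsub>Q\<^esub> u h = i (obstruction u (g, h)) \<otimes>\<^bsub>Q\<^esub> u (g \<otimes>\<^bsub>G\<^esub> h)"
    using u assms(3,4) by (simp_all add: obstruction_def j Q.act_closed Q.Q.m_assoc)
qed

text \<open>The relation in \<open>obstruction_value\<close> determines the factor: cancel the value
  of \<open>u\<close> and apply injectivity of \<open>i\<close>.\<close>

lemma obstruction_eqI:
  assumes "\<gamma> \<in> Z1 G S aS" "lifts \<gamma> u" "g \<in> carrier G" "h \<in> carrier G" "r \<in> carrier R"
    and "aQ (u g) h \<otimes>\<^bsub>Q\<^esub> u h = i r \<otimes>\<^bsub>Q\<^esub> u (g \<otimes>\<^bsub>G\<^esub> h)"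
  shows "obstruction u (g, h) = r"
proof -
  have "u (g \<otimes>\<^bsub>G\<^esub> h) \<in> carrier Q"
    using assms by (simp add: lifts_def)
  then show ?thesis
    using assms obstruction_value[OF assms(1-4)] by (simp add: i_eq_iff)
qed

text \<open>Associativity: the product of u(g)^(hk), u(h)^k and u(k) is a central multiple of u(ghk)
  in two ways, according to which two factors are combined first.\<close>

lemma obstruction_Z2:
  assumes "\<gamma> \<in> Z1 G S aS" "lifts \<gamma> u"
  shows "obstruction u \<in> Z2 G R aR"
proof (rule Z2I)
  show "obstruction u \<in> carrier G \<times> carrier G \<rightarrow>\<^sub>E carrier R"
    using obstruction_value(1)[OF assms] by (auto simp: obstruction_def)
  fix g h k assume ghk: "g \<in> carrier G" "h \<in> carrier G" "k \<in> carrier G"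
  let ?c = "obstruction u"
  note c = obstruction_value[OF assms]
  have u: "u g \<in> carrier Q" if "g \<in> carrier G" for g
    using assms that by (simp add: lifts_def)
  have "i (aR (?c (g, h)) k \<otimes>\<^bsub>R\<^esub> ?c (g \<otimes>\<^bsub>G\<^esub> h, k)) \<otimes>\<^bsub>Q\<^esub> u (g \<otimes>\<^bsub>G\<^esub> h \<otimes>\<^bsub>G\<^esub> k) =
      aQ (i (?c (g, h)) \<otimes>\<^bsub>Q\<^esub> u (g \<otimes>\<^bsub>G\<^esub> h)) k \<otimes>\<^bsub>Q\<^esub> u k"
    using ghk c by (simp add: u Q.act_simps R.act_simps i.hom_act Q.Q.m_assoc)
  also have "\<dots> = aQ (u g) (h \<otimes>\<^bsub>G\<^esub> k) \<otimes>\<^bsub>Q\<^esub> (aQ (u h) k \<otimes>\<^bsub>Q\<^esub> u k)"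
    using ghk by (simp add: u Q.act_simps Q.Q.m_assoc flip: c(2))
  also have "\<dots> = i (?c (h, k)) \<otimes>\<^bsub>Q\<^esub> (aQ (u g) (h \<otimes>\<^bsub>G\<^esub> k) \<otimes>\<^bsub>Q\<^esub> u (h \<otimes>\<^bsub>G\<^esub> k))"
    unfolding c(2)[OF ghk(2,3)] using ghk c(1) by (intro left_commute) (simp_all add: u Q.act_closed)
  also have "\<dots> = i (?c (h, k) \<otimes>\<^bsub>R\<^esub> ?c (g, h \<otimes>\<^bsub>G\<^esub> k)) \<otimes>\<^bsub>Q\<^esub> u (g \<otimes>\<^bsub>G\<^esub> h \<otimes>\<^bsub>G\<^esub> k)"
    using ghk c by (simp add: u Q.Q.m_assoc R.G.m_assoc)
  finally have "aR (?c (g, h)) k \<otimes>\<^bsub>R\<^esub> ?c (g \<otimes>\<^bsub>G\<^esub> h, k) = ?c (h, k) \<otimes>\<^bsub>R\<^esub> ?c (g, h \<otimes>\<^bsub>G\<^esub> k)"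
    using ghk c(1) by (simp add: u R.act_closed i_eq_iff del: i.hom_mult)
  then show "?c (g \<otimes>\<^bsub>G\<^esub> h, k) \<otimes>\<^bsub>R\<^esub> aR (?c (g, h)) k = ?c (g, h \<otimes>\<^bsub>G\<^esub> k) \<otimes>\<^bsub>R\<^esub> ?c (h, k)"
    using ghk c(1) by (simp add: R.act_closed R.R.m_comm)
qed

text \<open>The central factors gather to \<phi>(g)^h \<phi>(h), which is the coboundary times
  \<phi>(gh).\<close>

lemma obstruction_modify:
  assumes "\<gamma> \<in> Z1 G S aS" "lifts \<gamma> u" "lifts \<gamma> v" "\<phi> \<in> carrier G \<rightarrow> carrier R"
    and v: "\<And>g. g \<in> carrier G \<Longrightarrow> v g = u g \<otimes>\<^bsub>Q\<^esub> i (\<phi> g)"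
    and gh: "g \<in> carrier G" "h \<in> carrier G"
  shows "obstruction v (g, h) = obstruction u (g, h) \<otimes>\<^bsub>R\<^esub> R.coboundary \<phi> g h"
proof (rule obstruction_eqI)
  let ?c = "obstruction u (g, h)"
  note c = obstruction_value[OF assms(1,2) gh]
  have u: "u g \<in> carrier Q" "u h \<in> carrier Q" "u (g \<otimes>\<^bsub>G\<^esub> h) \<in> carrier Q"
    and \<phi>: "\<phi> g \<in> carrier R" "\<phi> h \<in> carrier R" "\<phi> (g \<otimes>\<^bsub>G\<^esub> h) \<in> carrier R"
    using assms by (auto simp: lifts_def)
  \<comment> \<open>In this form the last factor \<phi>(gh) can be absorbed into v(gh).\<close>
  have cb: "R.coboundary \<phi> g h \<otimes>\<^bsub>R\<^esub> \<phi> (g \<otimes>\<^bsub>G\<^esub> h) = aR (\<phi> g) h \<otimes>\<^bsub>R\<^esub> \<phi> h"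
    using \<phi> gh by (simp add: R.coboundary_def R.act_closed R.Q.m_assoc)
  have cbc: "R.coboundary \<phi> g h \<in> carrier R"
    using assms(4) gh by (rule R.coboundary_closed)
  have "aQ (v g) h \<otimes>\<^bsub>Q\<^esub> v h = aQ (u g) h \<otimes>\<^bsub>Q\<^esub> i (aR (\<phi> g) h) \<otimes>\<^bsub>Q\<^esub> u h \<otimes>\<^bsub>Q\<^esub> i (\<phi> h)"
    using u \<phi> gh by (simp add: v Q.act_simps i.hom_act Q.Q.m_assoc)
  also have "\<dots> = aQ (u g) h \<otimes>\<^bsub>Q\<^esub> u h \<otimes>\<^bsub>Q\<^esub> i (aR (\<phi> g) h \<otimes>\<^bsub>R\<^esub> \<phi> h)"
    using u \<phi> gh left_commute[of "aR (\<phi> g) h" "u h" "i (\<phi> h)"]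
    by (simp add: Q.act_closed R.act_closed Q.Q.m_assoc)
  also have "\<dots> = i ?c \<otimes>\<^bsub>Q\<^esub> u (g \<otimes>\<^bsub>G\<^esub> h) \<otimes>\<^bsub>Q\<^esub> i (R.coboundary \<phi> g h \<otimes>\<^bsub>R\<^esub> \<phi> (g \<otimes>\<^bsub>G\<^esub> h))"
    by (simp only: cb c(2))
  also have "\<dots> = i (?c \<otimes>\<^bsub>R\<^esub> R.coboundary \<phi> g h) \<otimes>\<^bsub>Q\<^esub> v (g \<otimes>\<^bsub>G\<^esub> h)"
    using u \<phi> gh c(1) cbc left_commute[of "R.coboundary \<phi> g h" "u (g \<otimes>\<^bsub>G\<^esub> h)"]
    by (simp add: v Q.Q.m_assoc)
  finally show "aQ (v g) h \<otimes>\<^bsub>Q\<^esub> v h =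
      i (?c \<otimes>\<^bsub>R\<^esub> R.coboundary \<phi> g h) \<otimes>\<^bsub>Q\<^esub> v (g \<otimes>\<^bsub>G\<^esub> h)" .
  show "?c \<otimes>\<^bsub>R\<^esub> R.coboundary \<phi> g h \<in> carrier R"
    using c(1) cbc by simp
qed fact+

lemma obstruction_rel:
  assumes "\<gamma> \<in> Z1 G S aS" "lifts \<gamma> u" "lifts \<gamma> v"
  shows "(obstruction u, obstruction v) \<in> H2_rel G R aR"
proof -
  obtain \<phi> where \<phi>: "\<phi> \<in> carrier G \<rightarrow>\<^sub>E carrier R"
    "\<And>g. g \<in> carrier G \<Longrightarrow> v g = u g \<otimes>\<^bsub>Q\<^esub> i (\<phi> g)"
    using p_eq_cochainE[of u v] assms(2,3) unfolding lifts_def by metis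
  have Pi: "\<phi> \<in> carrier G \<rightarrow> carrier R"
    using \<phi>(1) by (simp add: PiE_def)
  have "\<forall>g\<in>carrier G. \<forall>h\<in>carrier G.
      obstruction v (g, h) = obstruction u (g, h) \<otimes>\<^bsub>R\<^esub> R.coboundary \<phi> g h"
    by (intro ballI) (rule obstruction_modify[OF assms Pi \<phi>(2)])
  then show ?thesis
    unfolding R.H2_rel_iff
    using obstruction_Z2[OF assms(1,2)] obstruction_Z2[OF assms(1,3)] Pi by (intro conjI bexI)
qed

text \<open>Conjugate \<open>u\<close> by a lift \<open>t\<close> of the element relating \<gamma>
  to \<delta>. The obstruction is central, so conjugation leaves it literally unchanged, not merely
  cohomologous.\<close>

lemma obstruction_conj:
  assumes "(\<gamma>, \<delta>) \<in> H1_rel G S aS" "lifts \<gamma> u"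
  obtains v where "lifts \<delta> v" "obstruction v = obstruction u"
  using assms(1)
proof (rule H1_relE)
  fix s assume \<gamma>: "\<gamma> \<in> Z1 G S aS" and \<delta>: "\<delta> \<in> Z1 G S aS" and s: "s \<in> carrier S"
    and eq: "\<forall>g\<in>carrier G. \<delta> g = aS (inv\<^bsub>S\<^esub> s) g \<otimes>\<^bsub>S\<^esub> \<gamma> g \<otimes>\<^bsub>S\<^esub> s"
  define t where "t = \<sigma> s"
  have t: "t \<in> carrier Q" "p t = s"
    using s by (simp_all add: t_def section_closed p_section)
  define v where "v g = aQ (inv\<^bsub>Q\<^esub> t) g \<otimes>\<^bsub>Q\<^esub> u g \<otimes>\<^bsub>Q\<^esub> t" for g
  have u: "u g \<in> carrier Q" "p (u g) = \<gamma> g" if "g \<in> carrier G" for g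
    using assms(2) that by (auto simp: lifts_def)
  have v: "lifts \<delta> v"
    using u t eq by (simp add: lifts_def v_def Q.act_closed p.hom_act)
  have "obstruction v (g, h) = obstruction u (g, h)" if gh: "g \<in> carrier G" "h \<in> carrier G" for g h
  proof (rule obstruction_eqI[OF \<delta> v gh])
    note c = obstruction_value[OF \<gamma> assms(2) gh]
    show "obstruction u (g, h) \<in> carrier R" by (rule c(1))
    have "aQ (v g) h \<otimes>\<^bsub>Q\<^esub> v h =
        aQ (inv\<^bsub>Q\<^esub> t) (g \<otimes>\<^bsub>G\<^esub> h) \<otimes>\<^bsub>Q\<^esub> (aQ (u g) h \<otimes>\<^bsub>Q\<^esub> u h) \<otimes>\<^bsub>Q\<^esub> t"
      using gh t u by (simp add: v_def Q.act_simps Q.Q_simps)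
    also have "\<dots> = i (obstruction u (g, h)) \<otimes>\<^bsub>Q\<^esub> v (g \<otimes>\<^bsub>G\<^esub> h)"
      unfolding c(2) using gh t u c(1)
        left_commute[of _ "aQ (inv\<^bsub>Q\<^esub> t) (g \<otimes>\<^bsub>G\<^esub> h)" "u (g \<otimes>\<^bsub>G\<^esub> h) \<otimes>\<^bsub>Q\<^esub> t"]
      by (simp add: v_def Q.act_closed Q.Q.m_assoc)
    finally show "aQ (v g) h \<otimes>\<^bsub>Q\<^esub> v h = i (obstruction u (g, h)) \<otimes>\<^bsub>Q\<^esub> v (g \<otimes>\<^bsub>G\<^esub> h)" .
  qed
  then have "obstruction v = obstruction u"
    by (auto simp: obstruction_def fun_eq_iff)
  with v show thesis by (rule that)
qed

lemma section_lifts: "\<gamma> \<in> Z1 G S aS \<Longrightarrow> lifts \<gamma> (\<lambda>g. \<sigma> (\<gamma> g))"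
  by (simp add: lifts_def section_closed p_section Z1_closed)

text \<open>Equivalent cocycles have lifts with equal obstruction, and two lifts of one cocycle have
  cohomologous ones. Hence the union in \<open>connecting1\<close> collapses and any lift may be
  used in place of the section.\<close>

lemma connecting1_class:
  assumes \<gamma>: "\<gamma> \<in> Z1 G S aS" and u: "lifts \<gamma> u"
  shows "connecting1 G R aR Q aQ i \<sigma> (H1_class G S aS \<gamma>) = H2_class G R aR (obstruction u)"
proof -
  have "H2_class G R aR (obstruction (\<lambda>g. \<sigma> (\<delta> g))) = H2_class G R aR (obstruction (\<lambda>g. \<sigma> (\<epsilon> g)))"
    if \<delta>\<epsilon>: "(\<delta>, \<epsilon>) \<in> H1_rel G S aS" for \<delta> \<epsilon>
  proof -
    note Z = H1_relD[OF \<delta>\<epsilon>]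
    obtain v where v: "lifts \<epsilon> v" "obstruction v = obstruction (\<lambda>g. \<sigma> (\<delta> g))"
      using obstruction_conj[OF \<delta>\<epsilon> section_lifts[OF Z(1)]] .
    then show ?thesis
      using R.H2_class_eqI[OF obstruction_rel[OF Z(2) v(1) section_lifts[OF Z(2)]]] by simp
  qed
  then have "(\<Union>\<delta>\<in>H1_class G S aS \<gamma>. H2_class G R aR (obstruction (\<lambda>g. \<sigma> (\<delta> g)))) =
      H2_class G R aR (obstruction (\<lambda>g. \<sigma> (\<gamma> g)))"
    using \<gamma> by (rule S.UN_H1_class)
  then have "connecting1 G R aR Q aQ i \<sigma> (H1_class G S aS \<gamma>) =
      H2_class G R aR (obstruction (\<lambda>g. \<sigma> (\<gamma> g)))"
    by (simp only: connecting1_def obstruction_def)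
  also have "\<dots> = H2_class G R aR (obstruction u)"
    using R.H2_class_eqI[OF obstruction_rel[OF \<gamma> section_lifts[OF \<gamma>] u]] .
  finally show ?thesis .
qed

lemma obstruction_cocycle:
  assumes "\<gamma> \<in> Z1 G Q aQ"
  shows "obstruction \<gamma> = (\<lambda>x\<in>carrier G \<times> carrier G. \<one>\<^bsub>R\<^esub>)"
proof -
  have "j \<one>\<^bsub>Q\<^esub> = \<one>\<^bsub>R\<^esub>"
    using inj_i by (metis R.Q.one_closed i.hom_one inv_into_f_f)
  then show ?thesis
    using assms
    by (auto simp: obstruction_def fun_eq_iff Z1_mult Z1_closed Q.act_closed)
qed

text \<open>A cocycle lifting \<gamma> is a lift with trivial obstruction. Conversely, a cochain
  whose coboundary cancels the obstruction of \<open>u\<close> corrects \<open>u\<close> to a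
  cocycle.\<close>

lemma lift_cocycle_iff:
  assumes \<gamma>: "\<gamma> \<in> Z1 G S aS" and u: "lifts \<gamma> u"
  shows "(\<exists>\<delta>\<in>Z1 G Q aQ. \<gamma> = (\<lambda>g\<in>carrier G. p (\<delta> g))) \<longleftrightarrow>
    H2_class G R aR (obstruction u) = H2_base G R aR" (is "?lift \<longleftrightarrow> ?trivial")
proof
  assume ?lift
  then obtain \<delta> where \<delta>: "\<delta> \<in> Z1 G Q aQ" "\<gamma> = (\<lambda>g\<in>carrier G. p (\<delta> g))" ..
  then have "lifts \<gamma> \<delta>"
    by (simp add: lifts_def Z1_closed)
  then show ?trivial
    using R.H2_class_eqI[OF obstruction_rel[OF \<gamma> u]] obstruction_cocycle[OF \<delta>(1)]
    by (simp add: H2_base_def)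
next
  assume ?trivial
  then have "(obstruction u, \<lambda>x\<in>carrier G \<times> carrier G. \<one>\<^bsub>R\<^esub>) \<in> H2_rel G R aR"
    using R.H2_class_eq_iff[OF obstruction_Z2[OF \<gamma> u] R.trivial_Z2] by (simp add: H2_base_def)
  then obtain \<phi> where \<phi>: "\<phi> \<in> carrier G \<rightarrow> carrier R"
    "\<forall>g\<in>carrier G. \<forall>h\<in>carrier G. \<one>\<^bsub>R\<^esub> = obstruction u (g, h) \<otimes>\<^bsub>R\<^esub> R.coboundary \<phi> g h"
    unfolding R.H2_rel_iff by auto
  define \<delta> where "\<delta> = (\<lambda>g\<in>carrier G. u g \<otimes>\<^bsub>Q\<^esub> i (\<phi> g))"
  have \<delta>: "lifts \<gamma> \<delta>"
    using u \<phi>(1) Z1_closed[OF \<gamma>] by (auto simp: lifts_def \<delta>_def p_i Pi_iff)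
  have "\<delta> \<in> Z1 G Q aQ"
  proof (rule Z1I)
    show "\<delta> \<in> carrier G \<rightarrow>\<^sub>E carrier Q"
      using \<delta> by (auto simp: lifts_def) (simp add: \<delta>_def)
    fix g h assume gh: "g \<in> carrier G" "h \<in> carrier G"
    then have "obstruction \<delta> (g, h) = \<one>\<^bsub>R\<^esub>"
      using obstruction_modify[OF \<gamma> u \<delta> \<phi>(1) _ gh] \<phi>(2)[rule_format, OF gh, symmetric]
      by (simp add: \<delta>_def)
    then show "\<delta> (g \<otimes>\<^bsub>G\<^esub> h) = aQ (\<delta> g) h \<otimes>\<^bsub>Q\<^esub> \<delta> h"
      using obstruction_value(2)[OF \<gamma> \<delta> gh] \<delta> gh by (simp add: lifts_def)
  qed
  moreover have "\<gamma> = (\<lambda>g\<in>carrier G. p (\<delta> g))"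
    using \<delta> Z1_restrict_eq[OF \<gamma>] by (simp add: lifts_def cong: restrict_cong)
  ultimately show ?lift by blast
qed

section \<open>Base points and exactness of the row\<close>

lemma connecting0_pointed:
  "pointed_map (H0 G S aS) \<one>\<^bsub>S\<^esub> (H1 G R aR) (H1_base G R aR) (connecting0 G R aR Q aQ i \<sigma>)"
proof -
  have "connecting0 G R aR Q aQ i \<sigma> s \<in> H1 G R aR" if "s \<in> H0 G S aS" for s
  proof -
    have "s \<in> carrier S" using that by (simp add: H0_def)
    with that show ?thesis
      using connecting0_class[of "\<sigma> s"] difference_cocycle[of "\<sigma> s"]
      by (simp add: section_closed p_section H1_class_in_H1)
  qed
  moreover have "connecting0 G R aR Q aQ i \<sigma> \<one>\<^bsub>S\<^esub> = H1_base G R aR"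
  proof -
    \<comment> \<open>The lift 1 replaces the value of \<sigma> at 1, which may be any element of
      the kernel of \<open>p\<close>.\<close>
    have "difference \<one>\<^bsub>Q\<^esub> = (\<lambda>g\<in>carrier G. \<one>\<^bsub>R\<^esub>)"
    proof (rule Z1_eqI[OF difference_cocycle R.trivial_cocycle])
      fix g assume "g \<in> carrier G"
      moreover from this have "i (difference \<one>\<^bsub>Q\<^esub> g) = i \<one>\<^bsub>R\<^esub>"
        by (simp add: difference_value S.one_in_H0 Q.act_of_one)
      ultimately show "difference \<one>\<^bsub>Q\<^esub> g = (\<lambda>g\<in>carrier G. \<one>\<^bsub>R\<^esub>) g"
        by (simp add: i_eq_iff difference_value(1) S.one_in_H0 del: i.hom_one)
    qed (simp_all add: S.one_in_H0)
    then show ?thesis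
      using connecting0_class[of "\<one>\<^bsub>Q\<^esub>"] by (simp add: S.one_in_H0 H1_base_def)
  qed
  ultimately show ?thesis
    by (simp add: pointed_map_def S.one_in_H0 R.H1_base_in)
qed

lemma connecting1_pointed:
  "pointed_map (H1 G S aS) (H1_base G S aS) (H2 G R aR) (H2_base G R aR)
    (connecting1 G R aR Q aQ i \<sigma>)"
proof -
  have "connecting1 G R aR Q aQ i \<sigma> c \<in> H2 G R aR" if "c \<in> H1 G S aS" for c
    using that
    by (auto elim!: H1E simp: connecting1_class[OF _ section_lifts]
        intro!: H2_class_in_H2 obstruction_Z2 section_lifts)
  moreover have "connecting1 G R aR Q aQ i \<sigma> (H1_base G S aS) = H2_base G R aR"
  proof -
    \<comment> \<open>The constant lift 1 is itself a cocycle, so its obstruction is trivial even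
      when \<sigma> does not preserve 1.\<close>
    have "lifts (\<lambda>g\<in>carrier G. \<one>\<^bsub>S\<^esub>) (\<lambda>g\<in>carrier G. \<one>\<^bsub>Q\<^esub>)"
      by (simp add: lifts_def)
    then show ?thesis
      by (simp add: H1_base_def H2_base_def connecting1_class S.trivial_cocycle
          obstruction_cocycle[OF Q.trivial_cocycle])
  qed
  ultimately show ?thesis
    by (simp add: pointed_map_def S.H1_base_in R.H2_base_in)
qed

text \<open>A cocycle \<rho> of \<open>R\<close> becomes trivial in \<open>Q\<close> exactly when
  \<open>i (\<rho> g)\<close> is q^(-g) q for some \<open>q\<close>, that is, when \<rho> is the
  difference cocycle of a \<open>q\<close> with fixed image in \<open>S\<close>.\<close>

lemma exact_at_H1_R:
  "exact_at (H0 G S aS) (connecting0 G R aR Q aQ i \<sigma>)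
    (H1 G R aR) (H1_map G Q aQ i) (H1_base G Q aQ)"
  unfolding exact_at_def
proof (intro equalityI subsetI)
  fix c assume "c \<in> connecting0 G R aR Q aQ i \<sigma> ` H0 G S aS"
  then obtain s where s: "s \<in> H0 G S aS" "c = connecting0 G R aR Q aQ i \<sigma> s"
    by blast
  define q where "q = \<sigma> s"
  have q: "q \<in> carrier Q" "p q = s"
    using s(1) by (auto simp: q_def H0_def section_closed p_section)
  then have c: "c = H1_class G R aR (difference q)" and Z: "difference q \<in> Z1 G R aR"
    using s connecting0_class[of q] difference_cocycle[of q] by auto
  have "(\<lambda>g\<in>carrier G. \<one>\<^bsub>Q\<^esub>, \<lambda>g\<in>carrier G. i (difference q g)) \<in> H1_rel G Q aQ"
    using q s by (intro H1_relI[OF Q.trivial_cocycle i.map_cocycle[OF Z] q(1)])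
      (simp add: difference_value Q.act_closed)
  then show "c \<in> {c \<in> H1 G R aR. H1_map G Q aQ i c = H1_base G Q aQ}"
    using Q.H1_class_eqI c Z by (simp add: H1_class_in_H1 i.H1_map_class H1_base_def)
next
  fix c assume "c \<in> {c \<in> H1 G R aR. H1_map G Q aQ i c = H1_base G Q aQ}"
  then obtain \<rho> where \<rho>: "\<rho> \<in> Z1 G R aR" "c = H1_class G R aR \<rho>"
    and base: "H1_map G Q aQ i c = H1_base G Q aQ"
    by (auto elim: H1E)
  from base have "(\<lambda>g\<in>carrier G. \<one>\<^bsub>Q\<^esub>, \<lambda>g\<in>carrier G. i (\<rho> g)) \<in> H1_rel G Q aQ"
    using \<rho> Q.H1_class_eq_iff[OF Q.trivial_cocycle i.map_cocycle[OF \<rho>(1)]]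
    by (simp add: i.H1_map_class H1_base_def)
  then obtain q where q: "q \<in> carrier Q"
    and "\<forall>g\<in>carrier G. (\<lambda>g\<in>carrier G. i (\<rho> g)) g =
      aQ (inv\<^bsub>Q\<^esub> q) g \<otimes>\<^bsub>Q\<^esub> (\<lambda>g\<in>carrier G. \<one>\<^bsub>Q\<^esub>) g \<otimes>\<^bsub>Q\<^esub> q"
    by (rule H1_relE)
  then have eq: "i (\<rho> g) = inv\<^bsub>Q\<^esub> (aQ q g) \<otimes>\<^bsub>Q\<^esub> q" if "g \<in> carrier G" for g
    using that by (simp add: Q.act_simps)
  have "aS (p q) g = p q" if g: "g \<in> carrier G" for g
  proof -
    \<comment> \<open>Applying \<open>p\<close> removes the factor from \<open>R\<close> and shows
      that the image of \<open>q\<close> is fixed.\<close>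
    have "q = aQ q g \<otimes>\<^bsub>Q\<^esub> i (\<rho> g)"
      using g q by (simp add: eq Q.act_closed Q.Q_simps)
    then have "p q = p (aQ q g \<otimes>\<^bsub>Q\<^esub> i (\<rho> g))"
      by simp
    then show ?thesis
      using g q \<rho>(1) by (simp add: Q.act_closed S.act_closed Z1_closed p_i p.hom_act)
  qed
  then have pq: "p q \<in> H0 G S aS"
    using q by (simp add: H0_def)
  have "\<rho> = difference q"
  proof (rule Z1_eqI[OF \<rho>(1) difference_cocycle[OF q pq]])
    fix g assume g: "g \<in> carrier G"
    then have "i (\<rho> g) = i (difference q g)"
      using q pq by (simp add: eq difference_value Q.act_inv)
    then show "\<rho> g = difference q g"
      using g q pq \<rho>(1) by (simp add: i_eq_iff Z1_closed difference_value(1))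
  qed
  then show "c \<in> connecting0 G R aR Q aQ i \<sigma> ` H0 G S aS"
    using connecting0_class[OF q pq] \<rho>(2) pq by blast
qed

text \<open>The nontrivial inclusion is \<open>fibre_translate\<close> at the trivial cocycle, whose
  translate by \<rho> is the image of \<rho>.\<close>

lemma exact_at_H1_Q:
  "exact_at (H1 G R aR) (H1_map G Q aQ i) (H1 G Q aQ) (H1_map G S aS p) (H1_base G S aS)"
  unfolding exact_at_def
proof (intro equalityI subsetI)
  fix c assume "c \<in> H1_map G Q aQ i ` H1 G R aR"
  then obtain \<rho> where \<rho>: "\<rho> \<in> Z1 G R aR" "c = H1_class G Q aQ (\<lambda>g\<in>carrier G. i (\<rho> g))"
    by (auto elim!: H1E simp: i.H1_map_class)
  then show "c \<in> {c \<in> H1 G Q aQ. H1_map G S aS p c = H1_base G S aS}"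
    using i.map_cocycle[OF \<rho>(1)]
    by (simp add: H1_class_in_H1 p.H1_map_class H1_base_def p_i Z1_closed cong: restrict_cong)
next
  fix c assume "c \<in> {c \<in> H1 G Q aQ. H1_map G S aS p c = H1_base G S aS}"
  then obtain \<gamma> where \<gamma>: "\<gamma> \<in> Z1 G Q aQ" "c = H1_class G Q aQ \<gamma>"
    and base: "H1_map G S aS p c = H1_base G S aS"
    by (auto elim: H1E)
  let ?e = "\<lambda>g\<in>carrier G. \<one>\<^bsub>Q\<^esub>"
  have "(\<lambda>g\<in>carrier G. p (?e g), \<lambda>g\<in>carrier G. p (\<gamma> g)) \<in> H1_rel G S aS"
    using base \<gamma> S.H1_class_eq_iff[OF S.trivial_cocycle p.map_cocycle[OF \<gamma>(1)]]
    by (simp add: p.H1_map_class H1_base_def cong: restrict_cong)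
  then obtain \<rho> where \<rho>: "\<rho> \<in> Z1 G R aR" "(translate ?e \<rho>, \<gamma>) \<in> H1_rel G Q aQ"
    using fibre_translate[OF Q.trivial_cocycle \<gamma>(1)] by blast
  moreover have "translate ?e \<rho> = (\<lambda>g\<in>carrier G. i (\<rho> g))"
    using \<rho>(1) by (simp add: translate_def Z1_closed cong: restrict_cong)
  ultimately have "c = H1_map G Q aQ i (H1_class G R aR \<rho>)"
    using \<gamma> Q.H1_class_eqI by (simp add: i.H1_map_class)
  then show "c \<in> H1_map G Q aQ i ` H1 G R aR"
    using \<rho>(1) H1_class_in_H1 by blast
qed

lemma exact_at_H1_S:
  "exact_at (H1 G Q aQ) (H1_map G S aS p)
    (H1 G S aS) (connecting1 G R aR Q aQ i \<sigma>) (H2_base G R aR)"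
  unfolding exact_at_def
proof (intro equalityI subsetI)
  fix c assume "c \<in> H1_map G S aS p ` H1 G Q aQ"
  then obtain \<delta> where \<delta>: "\<delta> \<in> Z1 G Q aQ" "c = H1_class G S aS (\<lambda>g\<in>carrier G. p (\<delta> g))"
    by (auto elim!: H1E simp: p.H1_map_class)
  note Z = p.map_cocycle[OF \<delta>(1)]
  then show "c \<in> {c \<in> H1 G S aS. connecting1 G R aR Q aQ i \<sigma> c = H2_base G R aR}"
    using \<delta> lift_cocycle_iff[OF Z section_lifts[OF Z]] connecting1_class[OF Z section_lifts[OF Z]]
    by (auto simp: H1_class_in_H1)
next
  fix c assume "c \<in> {c \<in> H1 G S aS. connecting1 G R aR Q aQ i \<sigma> c = H2_base G R aR}"
  then obtain \<gamma> where \<gamma>: "\<gamma> \<in> Z1 G S aS" "c = H1_class G S aS \<gamma>"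
    and "connecting1 G R aR Q aQ i \<sigma> c = H2_base G R aR"
    by (auto elim: H1E)
  then obtain \<delta> where \<delta>: "\<delta> \<in> Z1 G Q aQ" "\<gamma> = (\<lambda>g\<in>carrier G. p (\<delta> g))"
    using lift_cocycle_iff[OF \<gamma>(1) section_lifts[OF \<gamma>(1)]]
      connecting1_class[OF \<gamma>(1) section_lifts[OF \<gamma>(1)]] by auto
  then have "c = H1_map G S aS p (H1_class G Q aQ \<delta>)"
    using \<gamma>(2) by (simp add: p.H1_map_class)
  then show "c \<in> H1_map G S aS p ` H1 G Q aQ"
    using \<delta>(1) H1_class_in_H1 by blast
qed

theorem exact_row: "exact_row G R aR Q aQ S aS i p \<sigma>"
  unfolding exact_row_def
  using connecting0_pointed i.H1_map_pointed p.H1_map_pointed connecting1_pointed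
    exact_at_H1_R exact_at_H1_Q exact_at_H1_S by blast

end

section \<open>Restriction to a subgroup\<close>

context G_group
begin

lemma H1_res_surj_iff:
  assumes B: "subgroup B G"
  shows "H1_res G B Q a ` H1 G Q a = H1 (G\<lparr>carrier := B\<rparr>) Q a \<longleftrightarrow>
    (\<forall>\<beta>\<in>Z1 (G\<lparr>carrier := B\<rparr>) Q a. \<exists>\<gamma>\<in>Z1 G Q a.
      (restrict \<gamma> B, \<beta>) \<in> H1_rel (G\<lparr>carrier := B\<rparr>) Q a)"
    (is "?surj \<longleftrightarrow> ?lift")
proof -
  interpret K: G_group "G\<lparr>carrier := B\<rparr>" Q a
    using B by (rule G_group_subgroup)
  show ?thesis
  proof (intro iffI ballI)
    fix \<beta> assume ?surj and \<beta>: "\<beta> \<in> Z1 (G\<lparr>carrier := B\<rparr>) Q a"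
    from \<beta> have "H1_class (G\<lparr>carrier := B\<rparr>) Q a \<beta> \<in> H1_res G B Q a ` H1 G Q a"
      unfolding \<open>?surj\<close> by (rule H1_class_in_H1)
    then obtain \<gamma> where "\<gamma> \<in> Z1 G Q a"
      "H1_class (G\<lparr>carrier := B\<rparr>) Q a (restrict \<gamma> B) = H1_class (G\<lparr>carrier := B\<rparr>) Q a \<beta>"
      using B by (auto elim!: H1E simp: H1_res_class)
    with \<beta> B show "\<exists>\<gamma>\<in>Z1 G Q a. (restrict \<gamma> B, \<beta>) \<in> H1_rel (G\<lparr>carrier := B\<rparr>) Q a"
      by (auto simp: K.H1_class_eq_iff restrict_cocycle)
  next
    assume lift: ?lift
    have "H1_res G B Q a ` H1 G Q a \<subseteq> H1 (G\<lparr>carrier := B\<rparr>) Q a"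
      using H1_res_pointed[OF B] by (auto simp: pointed_map_def)
    moreover have "c \<in> H1_res G B Q a ` H1 G Q a" if c: "c \<in> H1 (G\<lparr>carrier := B\<rparr>) Q a" for c
    proof -
      obtain \<beta> where \<beta>: "\<beta> \<in> Z1 (G\<lparr>carrier := B\<rparr>) Q a" "c = H1_class (G\<lparr>carrier := B\<rparr>) Q a \<beta>"
        using c by (rule H1E)
      with lift obtain \<gamma> where \<gamma>: "\<gamma> \<in> Z1 G Q a"
        "(restrict \<gamma> B, \<beta>) \<in> H1_rel (G\<lparr>carrier := B\<rparr>) Q a"
        by blast
      then have "c = H1_res G B Q a (H1_class G Q a \<gamma>)"
        using B \<beta>(2) K.H1_class_eqI by (simp add: H1_res_class)
      with \<gamma>(1) show ?thesis
        using H1_class_in_H1 by blast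
    qed
    ultimately show ?surj by blast
  qed
qed

lemma H1_res_inj_iff:
  assumes B: "subgroup B G"
  shows "inj_on (H1_res G B Q a) (H1 G Q a) \<longleftrightarrow>
    (\<forall>\<gamma>\<in>Z1 G Q a. \<forall>\<delta>\<in>Z1 G Q a.
      (restrict \<gamma> B, restrict \<delta> B) \<in> H1_rel (G\<lparr>carrier := B\<rparr>) Q a \<longrightarrow> (\<gamma>, \<delta>) \<in> H1_rel G Q a)"
    (is "?inj \<longleftrightarrow> ?reflect")
proof -
  interpret K: G_group "G\<lparr>carrier := B\<rparr>" Q a
    using B by (rule G_group_subgroup)
  show ?thesis
  proof
    assume inj: ?inj
    show ?reflect
    proof (intro ballI impI)
      fix \<gamma> \<delta> assume Z: "\<gamma> \<in> Z1 G Q a" "\<delta> \<in> Z1 G Q a"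
        and "(restrict \<gamma> B, restrict \<delta> B) \<in> H1_rel (G\<lparr>carrier := B\<rparr>) Q a"
      then have "H1_res G B Q a (H1_class G Q a \<gamma>) = H1_res G B Q a (H1_class G Q a \<delta>)"
        using B K.H1_class_eqI by (simp add: H1_res_class)
      then have "H1_class G Q a \<gamma> = H1_class G Q a \<delta>"
        using inj Z by (auto dest: inj_onD simp: H1_class_in_H1)
      with Z show "(\<gamma>, \<delta>) \<in> H1_rel G Q a"
        by (simp add: H1_class_eq_iff)
    qed
  next
    assume reflect: ?reflect
    show ?inj
    proof (rule inj_onI)
      fix c d assume "c \<in> H1 G Q a" "d \<in> H1 G Q a" and eq: "H1_res G B Q a c = H1_res G B Q a d"
      then obtain \<gamma> \<delta> where \<gamma>: "\<gamma> \<in> Z1 G Q a" "c = H1_class G Q a \<gamma>"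
        and \<delta>: "\<delta> \<in> Z1 G Q a" "d = H1_class G Q a \<delta>"
        by (auto elim!: H1E)
      then have "(restrict \<gamma> B, restrict \<delta> B) \<in> H1_rel (G\<lparr>carrier := B\<rparr>) Q a"
        using eq B by (simp add: H1_res_class K.H1_class_eq_iff restrict_cocycle)
      with reflect \<gamma> \<delta> show "c = d"
        by (simp add: H1_class_eq_iff)
    qed
  qed
qed

lemma H0_subgroup: "subgroup B G \<Longrightarrow> H0 G Q a \<subseteq> H0 (G\<lparr>carrier := B\<rparr>) Q a"
  using subgroup.subset[of B G] by (auto simp: H0_def)

end

section \<open>Naturality of the row under restriction\<close>

context central_extension
begin

lemma central_extension_subgroup:
  "subgroup B G \<Longrightarrow> central_extension (G\<lparr>carrier := B\<rparr>) R aR Q aQ S aS i p \<sigma>"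
  by (simp add: central_extension_def central_extension_axioms_def R.G_group_subgroup
      Q.G_group_subgroup S.G_group_subgroup i.G_group_hom_subgroup p.G_group_hom_subgroup
      inj_i image_i central_i[unfolded image_i] section_closed p_section)

lemma restrict_translate:
  assumes B: "subgroup B G"
  shows "restrict (translate \<gamma> \<rho>) B =
    central_extension.translate (G\<lparr>carrier := B\<rparr>) Q i (restrict \<gamma> B) (restrict \<rho> B)"
proof -
  interpret K: central_extension "G\<lparr>carrier := B\<rparr>" R aR Q aQ S aS i p \<sigma>
    using B by (rule central_extension_subgroup)
  show ?thesis
    using subgroup.mem_carrier[OF B] by (auto simp: translate_def K.translate_def)
qed

lemma connecting0_res:
  assumes B: "subgroup B G" and s: "s \<in> H0 G S aS"
  shows "H1_res G B R aR (connecting0 G R aR Q aQ i \<sigma> s) =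
    connecting0 (G\<lparr>carrier := B\<rparr>) R aR Q aQ i \<sigma> s"
proof -
  interpret K: central_extension "G\<lparr>carrier := B\<rparr>" R aR Q aQ S aS i p \<sigma>
    using B by (rule central_extension_subgroup)
  have q: "\<sigma> s \<in> carrier Q" "p (\<sigma> s) = s"
    using s by (simp_all add: H0_def section_closed p_section)
  have "restrict (difference (\<sigma> s)) B = K.difference (\<sigma> s)"
    using subgroup.mem_carrier[OF B] by (auto simp: difference_def K.difference_def)
  moreover have "s \<in> H0 (G\<lparr>carrier := B\<rparr>) S aS"
    using S.H0_subgroup[OF B] s by blast
  ultimately show ?thesis
    using B q s connecting0_class[OF q(1)] K.connecting0_class[OF q(1)] difference_cocycle[OF q(1)]
    by (simp add: R.H1_res_class)
qed

text \<open>The same cochain \<open>u\<close> lifts the restricted cocycle, and its obstruction over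
  \<open>B\<close> is the restriction of its obstruction over \<open>G\<close>.\<close>

lemma obstruction_res:
  assumes B: "subgroup B G" and \<gamma>: "\<gamma> \<in> Z1 G S aS" and u: "lifts \<gamma> u"
  shows "H2_res G B R aR (H2_class G R aR (obstruction u)) =
    connecting1 (G\<lparr>carrier := B\<rparr>) R aR Q aQ i \<sigma> (H1_class (G\<lparr>carrier := B\<rparr>) S aS (restrict \<gamma> B))"
proof -
  interpret K: central_extension "G\<lparr>carrier := B\<rparr>" R aR Q aQ S aS i p \<sigma>
    using B by (rule central_extension_subgroup)
  have "restrict (obstruction u) (B \<times> B) = K.obstruction u"
    using subgroup.mem_carrier[OF B] by (auto simp: obstruction_def K.obstruction_def)
  moreover have "K.lifts (restrict \<gamma> B) u"
    using u subgroup.mem_carrier[OF B] by (simp add: lifts_def K.lifts_def)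
  ultimately show ?thesis
    using B \<gamma> u
    by (simp add: R.H2_res_class obstruction_Z2 K.connecting1_class S.restrict_cocycle)
qed

lemma connecting1_res:
  assumes B: "subgroup B G" and c: "c \<in> H1 G S aS"
  shows "H2_res G B R aR (connecting1 G R aR Q aQ i \<sigma> c) =
    connecting1 (G\<lparr>carrier := B\<rparr>) R aR Q aQ i \<sigma> (H1_res G B S aS c)"
proof -
  obtain \<gamma> where \<gamma>: "\<gamma> \<in> Z1 G S aS" "c = H1_class G S aS \<gamma>"
    using c by (rule H1E)
  then show ?thesis
    using B section_lifts[OF \<gamma>(1)] obstruction_res[OF B \<gamma>(1) section_lifts[OF \<gamma>(1)]]
    by (simp add: connecting1_class S.H1_res_class)
qed

lemma restriction_commutes:
  assumes B: "subgroup B G"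
  shows "restriction_commutes G B R aR Q aQ S aS i p \<sigma>"
proof -
  interpret K: central_extension "G\<lparr>carrier := B\<rparr>" R aR Q aQ S aS i p \<sigma>
    using B by (rule central_extension_subgroup)
  have "pointed_map (H0 G S aS) \<one>\<^bsub>S\<^esub> (H0 (G\<lparr>carrier := B\<rparr>) S aS) \<one>\<^bsub>S\<^esub> (H0_res G S aS)"
    using S.H0_subgroup[OF B] by (auto simp: pointed_map_def H0_res_def S.one_in_H0 K.S.one_in_H0)
  moreover have "H1_res G B R aR (connecting0 G R aR Q aQ i \<sigma> s) =
      connecting0 (G\<lparr>carrier := B\<rparr>) R aR Q aQ i \<sigma> (H0_res G S aS s)" if "s \<in> H0 G S aS" for s
    using B that by (simp add: connecting0_res H0_res_def)
  ultimately show ?thesis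
    using B unfolding restriction_commutes_def Let_def
    by (simp add: R.H1_res_pointed Q.H1_res_pointed S.H1_res_pointed R.H2_res_pointed
        i.H1_res_map p.H1_res_map connecting1_res)
qed

section \<open>The two halves of the diagram chase\<close>

lemma H1_res_Q_surj:
  assumes B: "subgroup B G"
    and h2: "H1_res G B R aR ` H1 G R aR = H1 (G\<lparr>carrier := B\<rparr>) R aR"
    and h4: "H1_res G B S aS ` H1 G S aS = H1 (G\<lparr>carrier := B\<rparr>) S aS"
    and h5: "inj_on (H2_res G B R aR) (H2 G R aR)"
  shows "H1_res G B Q aQ ` H1 G Q aQ = H1 (G\<lparr>carrier := B\<rparr>) Q aQ"
  unfolding Q.H1_res_surj_iff[OF B]
proof
  let ?K = "G\<lparr>carrier := B\<rparr>"
  interpret K: central_extension ?K R aR Q aQ S aS i p \<sigma>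
    using B by (rule central_extension_subgroup)
  fix \<beta> assume \<beta>: "\<beta> \<in> Z1 ?K Q aQ"
  let ?p\<beta> = "\<lambda>g\<in>carrier ?K. p (\<beta> g)"
  have p\<beta>: "?p\<beta> \<in> Z1 ?K S aS"
    using \<beta> by (rule K.p.map_cocycle)
  then obtain \<gamma> where \<gamma>: "\<gamma> \<in> Z1 G S aS" "(restrict \<gamma> B, ?p\<beta>) \<in> H1_rel ?K S aS"
    using h4 unfolding S.H1_res_surj_iff[OF B] by blast
  note u = section_lifts[OF \<gamma>(1)]
  \<comment> \<open>Over \<open>B\<close> the obstruction class belongs to the image of \<beta>,
    which lifts to \<beta> itself. It vanishes there, and injectivity in degree 2 makes it vanish
    over \<open>G\<close>.\<close>
  have "H2_res G B R aR (H2_class G R aR (obstruction (\<lambda>g. \<sigma> (\<gamma> g)))) =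
      connecting1 ?K R aR Q aQ i \<sigma> (H1_class ?K S aS ?p\<beta>)"
    using obstruction_res[OF B \<gamma>(1) u] K.S.H1_class_eqI[OF \<gamma>(2)] by simp
  also have "\<dots> = H2_base ?K R aR"
    using K.connecting1_class[OF p\<beta> K.section_lifts[OF p\<beta>]]
      K.lift_cocycle_iff[OF p\<beta> K.section_lifts[OF p\<beta>]] \<beta> by blast
  also have "\<dots> = H2_res G B R aR (H2_base G R aR)"
    using R.H2_res_pointed[OF B] by (simp add: pointed_map_def)
  finally have "H2_class G R aR (obstruction (\<lambda>g. \<sigma> (\<gamma> g))) = H2_base G R aR"
    using h5 obstruction_Z2[OF \<gamma>(1) u] by (auto dest: inj_onD simp: H2_class_in_H2 R.H2_base_in)
  then obtain \<delta> where \<delta>: "\<delta> \<in> Z1 G Q aQ" "\<gamma> = (\<lambda>g\<in>carrier G. p (\<delta> g))"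
    using lift_cocycle_iff[OF \<gamma>(1) u] by blast
  have \<delta>B: "restrict \<delta> B \<in> Z1 ?K Q aQ"
    using B \<delta>(1) by (rule Q.restrict_cocycle)
  have "(\<lambda>g\<in>carrier ?K. p (restrict \<delta> B g), ?p\<beta>) \<in> H1_rel ?K S aS"
    using \<gamma>(2) unfolding \<delta>(2) restrict_map_subgroup[OF B] by simp
  then obtain \<rho> where \<rho>: "\<rho> \<in> Z1 ?K R aR"
    "(K.translate (restrict \<delta> B) \<rho>, \<beta>) \<in> H1_rel ?K Q aQ"
    using K.fibre_translate[OF \<delta>B \<beta>] by blast
  \<comment> \<open>The correcting cocycle extends to \<open>G\<close> only up to equivalence;
    \<open>translate_rel_right\<close> shows that this is enough.\<close>
  obtain \<rho>' where \<rho>': "\<rho>' \<in> Z1 G R aR" "(restrict \<rho>' B, \<rho>) \<in> H1_rel ?K R aR"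
    using h2 \<rho>(1) unfolding R.H1_res_surj_iff[OF B] by blast
  have "(restrict (translate \<delta> \<rho>') B, \<beta>) \<in> H1_rel ?K Q aQ"
    unfolding restrict_translate[OF B]
    using K.translate_rel_right[OF \<delta>B \<rho>'(2)] \<rho>(2) by (rule K.Q.H1_rel_trans)
  then show "\<exists>\<gamma>\<in>Z1 G Q aQ. (restrict \<gamma> B, \<beta>) \<in> H1_rel ?K Q aQ"
    using translate_cocycle[OF \<delta>(1) \<rho>'(1)] by blast
qed

text \<open>Writing s for \<open>p q\<close> and c for the image of \<gamma>(g), both sides
  rearrange to s^g c = c s. Thus twisted fixed points are the images of those \<open>q\<close> whose
  conjugate of \<gamma> stays over the same cocycle of \<open>S\<close>.\<close>

lemma twist_fixed_iff:
  assumes "\<gamma> \<in> Z1 G Q aQ" "q \<in> carrier Q" "g \<in> carrier G"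
  shows "twist S aS (\<lambda>g\<in>carrier G. p (\<gamma> g)) (p q) g = p q \<longleftrightarrow>
    p (aQ (inv\<^bsub>Q\<^esub> q) g \<otimes>\<^bsub>Q\<^esub> \<gamma> g \<otimes>\<^bsub>Q\<^esub> q) = p (\<gamma> g)"
proof -
  define s t c where "s = p q" and "t = aS (p q) g" and "c = p (\<gamma> g)"
  have [simp]: "s \<in> carrier S" "t \<in> carrier S" "c \<in> carrier S"
    using assms by (simp_all add: s_def t_def c_def S.act_closed Z1_closed)
  have "inv\<^bsub>S\<^esub> c \<otimes>\<^bsub>S\<^esub> t \<otimes>\<^bsub>S\<^esub> c = s \<longleftrightarrow> t \<otimes>\<^bsub>S\<^esub> c = c \<otimes>\<^bsub>S\<^esub> s"
    using S.Q.inv_solve_left'[of s c "t \<otimes>\<^bsub>S\<^esub> c"] by (auto simp: S.Q.m_assoc)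
  also have "\<dots> \<longleftrightarrow> inv\<^bsub>S\<^esub> t \<otimes>\<^bsub>S\<^esub> c \<otimes>\<^bsub>S\<^esub> s = c"
    using S.Q.inv_solve_left'[of c t "c \<otimes>\<^bsub>S\<^esub> s"] by (auto simp: S.Q.m_assoc)
  finally show ?thesis
    using assms by (simp add: twist_def s_def t_def c_def Q.act_simps S.act_simps Z1_closed p.hom_act)
qed

text \<open>Surjectivity on twisted fixed points appears as an inclusion of sets, because
  restriction is there the identity on elements.\<close>

lemma H1_res_Q_inj:
  assumes B: "subgroup B G"
    and h2: "inj_on (H1_res G B R aR) (H1 G R aR)"
    and h4: "inj_on (H1_res G B S aS) (H1 G S aS)"
    and twisted: "\<And>\<gamma>. \<gamma> \<in> Z1 G S aS \<Longrightarrow>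
      H0 (G\<lparr>carrier := B\<rparr>) S (twist S aS (restrict \<gamma> B)) \<subseteq> H0 G S (twist S aS \<gamma>)"
  shows "inj_on (H1_res G B Q aQ) (H1 G Q aQ)"
  unfolding Q.H1_res_inj_iff[OF B]
proof (intro ballI impI)
  let ?K = "G\<lparr>carrier := B\<rparr>"
  interpret K: central_extension ?K R aR Q aQ S aS i p \<sigma>
    using B by (rule central_extension_subgroup)
  note BG = subgroup.mem_carrier[OF B]
  fix \<gamma> \<delta> assume \<gamma>: "\<gamma> \<in> Z1 G Q aQ" and \<delta>: "\<delta> \<in> Z1 G Q aQ"
    and rel: "(restrict \<gamma> B, restrict \<delta> B) \<in> H1_rel ?K Q aQ"
  let ?p\<gamma> = "\<lambda>g\<in>carrier G. p (\<gamma> g)" and ?p\<delta> = "\<lambda>g\<in>carrier G. p (\<delta> g)"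
  have "(restrict ?p\<gamma> B, restrict ?p\<delta> B) \<in> H1_rel ?K S aS"
    unfolding restrict_map_subgroup[OF B] using K.p.map_H1_rel[OF rel] by simp
  then have "(?p\<gamma>, ?p\<delta>) \<in> H1_rel G S aS"
    using h4 p.map_cocycle[OF \<gamma>] p.map_cocycle[OF \<delta>] unfolding S.H1_res_inj_iff[OF B] by blast
  then obtain \<rho> where \<rho>: "\<rho> \<in> Z1 G R aR" and \<rho>\<delta>: "(translate \<gamma> \<rho>, \<delta>) \<in> H1_rel G Q aQ"
    using fibre_translate[OF \<gamma> \<delta>] by blast
  have "(restrict \<gamma> B, restrict (translate \<gamma> \<rho>) B) \<in> H1_rel ?K Q aQ"
    using rel Q.restrict_H1_rel[OF B Q.H1_rel_sym[OF \<rho>\<delta>]] by (rule K.Q.H1_rel_trans)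
  then obtain q where q: "q \<in> carrier Q"
    and qB: "\<forall>g\<in>carrier ?K. restrict (translate \<gamma> \<rho>) B g =
      aQ (inv\<^bsub>Q\<^esub> q) g \<otimes>\<^bsub>Q\<^esub> restrict \<gamma> B g \<otimes>\<^bsub>Q\<^esub> q"
    by (rule H1_relE)
  have conj_B: "aQ (inv\<^bsub>Q\<^esub> q) g \<otimes>\<^bsub>Q\<^esub> \<gamma> g \<otimes>\<^bsub>Q\<^esub> q = \<gamma> g \<otimes>\<^bsub>Q\<^esub> i (\<rho> g)" if "g \<in> B" for g
    using qB that BG by (simp add: translate_def)
  \<comment> \<open>Over \<open>B\<close> the conjugate of \<gamma> by \<open>q\<close> is \<gamma>
    times a cocycle of \<open>R\<close>, so both have the same image in \<open>S\<close>.\<close>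
  have "twist S aS (restrict ?p\<gamma> B) (p q) g = p q" if g: "g \<in> B" for g
    using twist_fixed_iff[OF \<gamma> q BG[OF g]] conj_B[OF g] g BG[OF g] \<gamma> \<rho>
    by (simp add: twist_def Z1_closed p_i del: p.hom_mult) (simp add: Z1_closed p_i)
  then have "p q \<in> H0 ?K S (twist S aS (restrict ?p\<gamma> B))"
    using q by (simp add: H0_def)
  \<comment> \<open>The passage from \<open>B\<close> to \<open>G\<close>: an element
    \<open>q\<close> known only to conjugate over \<open>B\<close> now keeps \<gamma> in its fibre
    over all of \<open>G\<close>.\<close>
  then have fixed: "p q \<in> H0 G S (twist S aS ?p\<gamma>)"
    using twisted p.map_cocycle[OF \<gamma>] by blast
  define \<gamma>' where "\<gamma>' = (\<lambda>g\<in>carrier G. aQ (inv\<^bsub>Q\<^esub> q) g \<otimes>\<^bsub>Q\<^esub> \<gamma> g \<otimes>\<^bsub>Q\<^esub> q)"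
  have \<gamma>': "(\<gamma>, \<gamma>') \<in> H1_rel G Q aQ" "\<gamma>' \<in> Z1 G Q aQ"
    unfolding \<gamma>'_def using \<gamma> q by (simp_all add: Q.conj_cocycle_rel Q.conj_cocycle)
  have "p (\<gamma> g) = p (\<gamma>' g)" if g: "g \<in> carrier G" for g
    using fixed twist_fixed_iff[OF \<gamma> q g] g by (simp add: H0_def \<gamma>'_def del: p.hom_mult)
  then obtain \<rho>' where \<rho>': "\<rho>' \<in> carrier G \<rightarrow>\<^sub>E carrier R"
    "\<And>g. g \<in> carrier G \<Longrightarrow> \<gamma>' g = \<gamma> g \<otimes>\<^bsub>Q\<^esub> i (\<rho>' g)"
    using p_eq_cochainE[of \<gamma> \<gamma>'] Z1_closed[OF \<gamma>] Z1_closed[OF \<gamma>'(2)] by metis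
  then have Z: "\<rho>' \<in> Z1 G R aR"
    using cocycle_of_translate[OF \<gamma> \<gamma>'(2)] by blast
  have "\<gamma>' = translate \<gamma> \<rho>'"
    by (rule Z1_eqI[OF \<gamma>'(2) translate_cocycle[OF \<gamma> Z]]) (simp add: translate_def \<rho>'(2))
  with \<gamma>' have \<gamma>\<rho>': "(\<gamma>, translate \<gamma> \<rho>') \<in> H1_rel G Q aQ"
    by simp
  \<comment> \<open>On \<open>B\<close> both translates of \<gamma> equal its conjugate by
    \<open>q\<close>, so the factors agree exactly; injectivity on the cohomology of
    \<open>R\<close> then compares them over \<open>G\<close>.\<close>
  have "restrict \<rho>' B = restrict \<rho> B"
  proof (rule restrict_ext)
    fix g assume g: "g \<in> B"
    have "\<gamma> g \<otimes>\<^bsub>Q\<^esub> i (\<rho>' g) = \<gamma> g \<otimes>\<^bsub>Q\<^esub> i (\<rho> g)"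
      using conj_B[OF g] \<rho>'(2)[OF BG[OF g]] BG[OF g] by (simp add: \<gamma>'_def)
    then show "\<rho>' g = \<rho> g"
      using BG[OF g] \<gamma> \<rho> Z by (simp add: Z1_closed i_eq_iff)
  qed
  then have "(restrict \<rho>' B, restrict \<rho> B) \<in> H1_rel ?K R aR"
    using K.R.H1_rel_refl R.restrict_cocycle[OF B \<rho>] by simp
  then have "(\<rho>', \<rho>) \<in> H1_rel G R aR"
    using h2 Z \<rho> unfolding R.H1_res_inj_iff[OF B] by blast
  then have "(translate \<gamma> \<rho>', translate \<gamma> \<rho>) \<in> H1_rel G Q aQ"
    by (rule translate_rel_right[OF \<gamma>])
  then show "(\<gamma>, \<delta>) \<in> H1_rel G Q aQ"
    using \<gamma>\<rho>' \<rho>\<delta> Q.H1_rel_trans by blast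
qed

end

text \<open>Exactness of both rows and commutativity of the squares are part of the conclusion. The
  isomorphism in the last clause is a bijection preserving base points.\<close>

theorem theorem3p1p1:
  fixes G :: "('g, 'x) monoid_scheme" and B :: "'g set"
    and R :: "('r, 'u) monoid_scheme" and aR :: "'r \<Rightarrow> 'g \<Rightarrow> 'r"
    and Q :: "('q, 'v) monoid_scheme" and aQ :: "'q \<Rightarrow> 'g \<Rightarrow> 'q"
    and S :: "('s, 'w) monoid_scheme" and aS :: "'s \<Rightarrow> 'g \<Rightarrow> 's"
    and i :: "'r \<Rightarrow> 'q" and p :: "'q \<Rightarrow> 's" and \<sigma> :: "'s \<Rightarrow> 'q"
  assumes "group G" and "subgroup B G"
    and "G_group G R aR" and "G_group G Q aQ" and "G_group G S aS"
    and "i \<in> mon R Q" and "equivariant G R aR aQ i"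
    and "p \<in> epi Q S" and "equivariant G Q aQ aS p"
    and "i ` carrier R = kernel Q S p"
    and "i ` carrier R \<subseteq> group_center Q"
    and "\<sigma> \<in> carrier S \<rightarrow> carrier Q" and "\<forall>s\<in>carrier S. p (\<sigma> s) = s"
  shows "let K = G\<lparr>carrier := B\<rparr>;
      h2 = H1_res G B R aR; h3 = H1_res G B Q aQ; h4 = H1_res G B S aS; h5 = H2_res G B R aR;
      hyp_i = (h2 ` H1 G R aR = H1 K R aR \<and> h4 ` H1 G S aS = H1 K S aS \<and>
        inj_on h5 (H2 G R aR));
      hyp_ii = (inj_on h2 (H1 G R aR) \<and> inj_on h4 (H1 G S aS) \<and>
        (\<forall>\<gamma>\<in>Z1 G S aS. H0_res G S (twist S aS \<gamma>) ` H0 G S (twist S aS \<gamma>) =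
          H0 K S (twist S aS (restrict \<gamma> B))))
    in
      exact_row G R aR Q aQ S aS i p \<sigma> \<and>
      exact_row K R aR Q aQ S aS i p \<sigma> \<and>
      restriction_commutes G B R aR Q aQ S aS i p \<sigma> \<and>
      (hyp_i \<longrightarrow> h3 ` H1 G Q aQ = H1 K Q aQ) \<and>
      (hyp_ii \<longrightarrow> inj_on h3 (H1 G Q aQ)) \<and>
      (hyp_i \<and> hyp_ii \<longrightarrow>
        pointed_iso (H1 G Q aQ) (H1_base G Q aQ) (H1 K Q aQ) (H1_base K Q aQ) h3)"
proof -
  interpret R: G_group G R aR by fact
  interpret Q: G_group G Q aQ by fact
  interpret S: G_group G S aS by fact
  interpret central_extension G R aR Q aQ S aS i p \<sigma>
    using assms by unfold_locales (auto simp: mon_def epi_def)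
  note B = \<open>subgroup B G\<close>
  interpret K: central_extension "G\<lparr>carrier := B\<rparr>" R aR Q aQ S aS i p \<sigma>
    using B by (rule central_extension_subgroup)
  \<comment> \<open>Restriction is the identity on fixed points, so surjectivity of the twisted
    restriction becomes an equality of fixed-point sets.\<close>
  have H0_res_image: "H0_res G S b ` H0 G S b = H0 G S b" for b :: "'s \<Rightarrow> 'g \<Rightarrow> 's"
    by (simp add: H0_res_def)
  show ?thesis
    unfolding Let_def H0_res_image
    using exact_row K.exact_row restriction_commutes[OF B] H1_res_Q_surj[OF B] H1_res_Q_inj[OF B]
      Q.H1_res_pointed[OF B]
    by (simp add: pointed_iso_def bij_betw_def)
qed

end
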